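(* Let $\mathbb{F}$ be an arbitrary field and $n\ge 1$. The isomorphism classes of $n$-dimensional idempotent evolution algebras over $\mathbb{F}$ are in one-to-one correspondence with the orbits of the action of $G=S_n\ltimes T_n$ on $GL_n(\mathbb{F})$ given by $$\sigma t\colon A\mapsto (\sigma t)^{-1}A(\sigma t)^{(2)} = t^{-1}\sigma^{-1}A\,\sigma t^2,\qquad \sigma t\in G,\ A\in GL_n(\mathbb{F}),$$ where the orbit of $A$ corresponds to the isomorphism class of the evolution algebra $\mathcal{E}(A)$ with structure matrix $A$.
   Context: An $n$-dimensional evolution algebra over a field $\mathbb{F}$ is a (not necessarily associative) $\mathbb{F}$-algebra $\mathcal{E}$ having a vector space basis $e_1,\dots,e_n$ (a natural basis) such that $e_ie_j=0$ for $i\neq j$; its structure matrix with respect to this basis is the $n\times n$ matrix $A=(a_{ij})$ over $\mathbb{F}$ with $(e_1^2,\dots,e_n^2)=(e_1,\dots,e_n)A$. The evolution algebra with structure matrix $A$ is denoted $\mathcal{E}(A)$. An evolution algebra is called idempotent if $\mathcal{E}^2=\mathcal{E}$; this holds if and only if $A$ is nonsingular. Isomorphism means isomorphism of $\mathbb{F}$-algebras. A permutation $\sigma\in S_n$ is identified with the permutation matrix, also written $\sigma$, determined by $(e_{\sigma(1)},\dots,e_{\sigma(n)})=(e_1,\dots,e_n)\sigma$. $T_n\subset GL_n(\mathbb{F})$ is the subgroup of nonsingular diagonal matrices, and $G=S_n\ltimes T_n=\{\sigma t : \sigma\in S_n,\ t\in T_n\}$, a subgroup of $GL_n(\mathbb{F})$.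 For a matrix $M=(m_{ij})$, $M^{(2)}$ denotes the matrix $(m_{ij}^2)$; for $\sigma t\in G$ one has $(\sigma t)^{(2)}=\sigma t^2$. *)

theory Defs
  imports
    "HOL-Algebra.Group_Action"
    "HOL-Combinatorics.Permutations"
    "Jordan_Normal_Form.Matrix"
    "Jordan_Normal_Form.VS_Connect"
begin

text \<open>
  The field is an arbitrary type of class \<^class>\<open>field\<close>, and \<^term>\<open>class_ring\<close> is that type
  as a record of HOL-Algebra. Basis vectors, rows and columns are numbered from \<open>0\<close> to
  \<open>n - 1\<close> instead of from \<open>1\<close> to \<open>n\<close>.
\<close>

section \<open>Evolution algebras\<close>

text \<open>
  A not necessarily associative algebra is carried by a record of type \<^typ>\<open>('a, 'v) module\<close>.
  That record has a field for a unit element; no definition below refers to it.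
\<close>

locale nonassoc_algebra = vectorspace K V for K and V +
  assumes mult_closed: "x \<in> carrier V \<Longrightarrow> y \<in> carrier V \<Longrightarrow> x \<otimes>\<^bsub>V\<^esub> y \<in> carrier V"
    and mult_add_left: "x \<in> carrier V \<Longrightarrow> y \<in> carrier V \<Longrightarrow> z \<in> carrier V \<Longrightarrow>
      (x \<oplus>\<^bsub>V\<^esub> y) \<otimes>\<^bsub>V\<^esub> z = (x \<otimes>\<^bsub>V\<^esub> z) \<oplus>\<^bsub>V\<^esub> (y \<otimes>\<^bsub>V\<^esub> z)"
    and mult_add_right: "x \<in> carrier V \<Longrightarrow> y \<in> carrier V \<Longrightarrow> z \<in> carrier V \<Longrightarrow>
      z \<otimes>\<^bsub>V\<^esub> (x \<oplus>\<^bsub>V\<^esub> y) = (z \<otimes>\<^bsub>V\<^esub> x) \<oplus>\<^bsub>V\<^esub> (z \<otimes>\<^bsub>V\<^esub> y)"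
    and mult_smult_left: "c \<in> carrier K \<Longrightarrow> x \<in> carrier V \<Longrightarrow> y \<in> carrier V \<Longrightarrow>
      (c \<odot>\<^bsub>V\<^esub> x) \<otimes>\<^bsub>V\<^esub> y = c \<odot>\<^bsub>V\<^esub> (x \<otimes>\<^bsub>V\<^esub> y)"
    and mult_smult_right: "c \<in> carrier K \<Longrightarrow> x \<in> carrier V \<Longrightarrow> y \<in> carrier V \<Longrightarrow>
      x \<otimes>\<^bsub>V\<^esub> (c \<odot>\<^bsub>V\<^esub> y) = c \<odot>\<^bsub>V\<^esub> (x \<otimes>\<^bsub>V\<^esub> y)"

definition algebra_isomorphic ::
  "('a, 'c) ring_scheme \<Rightarrow> ('a, 'v) module \<Rightarrow> ('a, 'w) module \<Rightarrow> bool" where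
  "algebra_isomorphic K V W \<longleftrightarrow> (\<exists>f. f \<in> LinearCombinations.module_hom K V W \<and> f \<in> iso V W)"

definition natural_basis :: "nat \<Rightarrow> ('a :: field, 'v) module \<Rightarrow> (nat \<Rightarrow> 'v) \<Rightarrow> bool" where
  "natural_basis n V e \<longleftrightarrow>
     inj_on e {..<n} \<and> vectorspace.basis class_ring V (e ` {..<n}) \<and>
     (\<forall>i<n. \<forall>j<n. i \<noteq> j \<longrightarrow> e i \<otimes>\<^bsub>V\<^esub> e j = \<zero>\<^bsub>V\<^esub>)"

definition evolution_algebra :: "nat \<Rightarrow> ('a :: field, 'v) module \<Rightarrow> bool" where
  "evolution_algebra n V \<longleftrightarrow> nonassoc_algebra class_ring V \<and> (\<exists>e. natural_basis n V e)"

definition structure_matrix ::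
  "nat \<Rightarrow> ('a :: field, 'v) module \<Rightarrow> (nat \<Rightarrow> 'v) \<Rightarrow> 'a mat \<Rightarrow> bool" where
  "structure_matrix n V e A \<longleftrightarrow> A \<in> carrier_mat n n \<and>
     (\<forall>j<n. e j \<otimes>\<^bsub>V\<^esub> e j = (\<Oplus>\<^bsub>V\<^esub>i\<in>{..<n}. A $$ (i, j) \<odot>\<^bsub>V\<^esub> e i))"

text \<open>\<open>V\<^sup>2\<close> is the linear span of all products, not just the set of products.\<close>

definition idempotent_algebra :: "('a :: field, 'v) module \<Rightarrow> bool" where
  "idempotent_algebra V \<longleftrightarrow>
     LinearCombinations.module.span class_ring V
       {x \<otimes>\<^bsub>V\<^esub> y | x y. x \<in> carrier V \<and> y \<in> carrier V} = carrier V"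

definition idempotent_evolution_algebras :: "nat \<Rightarrow> ('a :: field, 'v) module set" where
  "idempotent_evolution_algebras n = {V. evolution_algebra n V \<and> idempotent_algebra V}"

definition isomorphism_rel :: "nat \<Rightarrow> (('a :: field, 'v) module \<times> ('a, 'v) module) set" where
  "isomorphism_rel n =
     {(V, W). V \<in> idempotent_evolution_algebras n \<and> W \<in> idempotent_evolution_algebras n \<and>
       algebra_isomorphic class_ring V W}"

text \<open>
  The algebra \<open>\<E>(A)\<close> lives on the space of column vectors, with the standard basis as natural
  basis: bilinearity and \<open>e\<^sub>i e\<^sub>j = 0\<close> for \<open>i \<noteq> j\<close> give
  \<open>x y = (\<Sum>i. x\<^sub>i y\<^sub>i e\<^sub>i\<^sup>2)\<close>, where \<open>e\<^sub>i\<^sup>2\<close> is column \<open>i\<close> of \<open>A\<close>.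
\<close>

definition evo :: "nat \<Rightarrow> 'a :: field mat \<Rightarrow> ('a, 'a vec) module" where
  "evo n A = module_vec TYPE('a) n
     \<lparr>mult := \<lambda>x y. A *\<^sub>v vec n (\<lambda>i. x $ i * y $ i)\<rparr>"

lemma evo_simps [simp]:
  fixes A :: "'a :: field mat"
  shows "carrier (evo n A) = carrier_vec n"
    and "add (evo n A) = (+)"
    and "zero (evo n A) = 0\<^sub>v n"
    and "smult (evo n A) = (\<cdot>\<^sub>v)"
    and "mult (evo n A) = (\<lambda>x y. A *\<^sub>v vec n (\<lambda>i. x $ i * y $ i))"
  by (simp_all add: evo_def module_vec_def)

lemma evo_nonassoc_algebra:
  fixes A :: "'a :: field mat"
  assumes A: "A \<in> carrier_mat n n"
  shows "nonassoc_algebra class_ring (evo n A)"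
proof -
  let ?V = "module_vec TYPE('a) n"
  have vsV: "vectorspace class_ring ?V" by (rule vec_vs)
  have add_eq: "add_monoid (evo n A) = add_monoid ?V" by (simp add: module_vec_simps)
  have "abelian_group ?V"
    using vec_module unfolding Module.module_def by blast
  then have ab: "abelian_group (evo n A)"
    unfolding abelian_group_def abelian_monoid_def abelian_group_axioms_def add_eq .
  have cr: "cring (class_ring :: 'a ring)"
    using vec_module unfolding Module.module_def by blast
  have "Module.module class_ring (evo n A)"
    by (rule moduleI[OF cr ab])
      (auto simp: add_smult_distrib_vec smult_add_distrib_vec smult_smult_assoc)
  then have vs: "vectorspace class_ring (evo n A)"
    using vsV unfolding vectorspace_def by blast
  show ?thesis
    by (intro nonassoc_algebra.intro vs nonassoc_algebra_axioms.intro)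
      (use A in \<open>auto simp: scalar_prod_def algebra_simps sum_distrib_left sum.distrib
        intro!: eq_vecI\<close>)
qed

lemma evo_structure_matrix:
  fixes A :: "'a :: field mat"
  assumes A: "A \<in> carrier_mat n n"
  shows "natural_basis n (evo n A) (unit_vec n)"
    and "structure_matrix n (evo n A) (unit_vec n) A"
proof -
  interpret vec_space "TYPE('a)" n .
  interpret E: nonassoc_algebra class_ring "evo n A"
    by (rule evo_nonassoc_algebra[OF A])
  have fs: "finsum (evo n A) = (finsum V :: ('b \<Rightarrow> _) \<Rightarrow> _)"
    by (simp add: finsum_def module_vec_simps)
  have lc: "E.lincomb = lincomb"
    by (intro ext) (simp add: E.lincomb_def lincomb_def finsum_def module_vec_simps)
  have "E.basis = basis"
    by (intro ext) (simp add: E.basis_def basis_def E.lin_dep_def lin_dep_def E.span_def span_def lc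
      module_vec_simps)
  moreover have "unit_vec n ` {..<n} = (set (unit_vecs n) :: 'a vec set)"
    by (auto simp: unit_vecs_def)
  ultimately have bas: "E.basis (unit_vec n ` {..<n})"
    using unit_vecs_basis by simp
  have inj: "inj_on (unit_vec n :: nat \<Rightarrow> 'a vec) {..<n}"
    by (auto simp: inj_on_def)
  have "unit_vec n i \<otimes>\<^bsub>evo n A\<^esub> unit_vec n j = \<zero>\<^bsub>evo n A\<^esub>"
    if "i < n" "j < n" "i \<noteq> j" for i j
  proof -
    have "vec n (\<lambda>k. unit_vec n i $ k * unit_vec n j $ k) = (0\<^sub>v n :: 'a vec)"
      using that by (intro eq_vecI) auto
    moreover have "A *\<^sub>v 0\<^sub>v n = 0\<^sub>v n"
      using A by (intro eq_vecI) auto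
    ultimately show ?thesis by simp
  qed
  with bas inj show "natural_basis n (evo n A) (unit_vec n)"
    by (auto simp: natural_basis_def)
  show "structure_matrix n (evo n A) (unit_vec n) A"
    unfolding structure_matrix_def
  proof (intro conjI A allI impI)
    fix j assume j: "j < n"
    have 1: "vec n (\<lambda>k. unit_vec n j $ k * unit_vec n j $ k) = (unit_vec n j :: 'a vec)"
      using j by (intro eq_vecI) auto
    have 2: "(\<Oplus>\<^bsub>V\<^esub>i\<in>{..<n}. A $$ (i, j) \<cdot>\<^sub>v unit_vec n i) = col A j"
    proof (rule eq_vecI)
      fix k assume k: "k < dim_vec (col A j)"
      have "(\<Oplus>\<^bsub>V\<^esub>i\<in>{..<n}. A $$ (i, j) \<cdot>\<^sub>v unit_vec n i) $ k =
          (\<Sum>i<n. (A $$ (i, j) \<cdot>\<^sub>v unit_vec n i) $ k)"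
        using A k unfolding finsum_vec[symmetric] by (intro index_finsum_vec) auto
      also have "\<dots> = (\<Sum>i<n. if i = k then A $$ (i, j) else 0)"
        using A k by (intro sum.cong) auto
      also have "\<dots> = col A j $ k" using A k j by simp
      finally show "(\<Oplus>\<^bsub>V\<^esub>i\<in>{..<n}. A $$ (i, j) \<cdot>\<^sub>v unit_vec n i) $ k = col A j $ k" .
    qed (use A in \<open>auto simp: finsum_dim\<close>)
    have 3: "A *\<^sub>v unit_vec n j = col A j"
      using A j by (intro eq_vecI) auto
    show "unit_vec n j \<otimes>\<^bsub>evo n A\<^esub> unit_vec n j =
        (\<Oplus>\<^bsub>evo n A\<^esub>i\<in>{..<n}. A $$ (i, j) \<odot>\<^bsub>evo n A\<^esub> unit_vec n i)"
      by (simp add: fs 1 2 3)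
  qed
qed

section \<open>The group and its action\<close>

definition GL :: "nat \<Rightarrow> 'a :: field mat monoid" where
  "GL n = units_of (ring_mat TYPE('a) n ())"

text \<open>Column \<open>j\<close> is the standard basis vector with index \<open>\<sigma> j\<close>.\<close>

definition perm_mat :: "nat \<Rightarrow> (nat \<Rightarrow> nat) \<Rightarrow> 'a :: field mat" where
  "perm_mat n \<sigma> = mat n n (\<lambda>(i, j). if i = \<sigma> j then 1 else 0)"

definition perm_mats :: "nat \<Rightarrow> 'a :: field mat set" where
  "perm_mats n = {perm_mat n \<sigma> | \<sigma>. \<sigma> permutes {..<n}}"

definition torus :: "nat \<Rightarrow> 'a :: field mat set" where
  "torus n = {t \<in> carrier (GL n). diagonal_mat t}"

definition monomial_group :: "nat \<Rightarrow> 'a :: field mat monoid" where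
  "monomial_group n = (GL n)\<lparr>carrier := {s * t | s t. s \<in> perm_mats n \<and> t \<in> torus n}\<rparr>"

definition evo_act :: "nat \<Rightarrow> 'a :: field mat \<Rightarrow> 'a mat \<Rightarrow> 'a mat" where
  "evo_act n g A = inv\<^bsub>GL n\<^esub> g * A * map_mat (\<lambda>x. x ^ 2) g"

text \<open>
  \<^const>\<open>evo_act\<close> reverses products: acting by \<open>g h\<close> is acting by \<open>g\<close> and then by \<open>h\<close>. The library
  constants \<^const>\<open>orbit\<close> and \<^const>\<open>orbits\<close> do not depend on the side of the action.
\<close>

definition right_action ::
  "('g, 'c) monoid_scheme \<Rightarrow> 'x set \<Rightarrow> ('g \<Rightarrow> 'x \<Rightarrow> 'x) \<Rightarrow> bool" where
  "right_action G X \<phi> \<longleftrightarrow> Group.group G \<and>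
     (\<forall>g \<in> carrier G. \<forall>x \<in> X. \<phi> g x \<in> X) \<and>
     (\<forall>x \<in> X. \<phi> \<one>\<^bsub>G\<^esub> x = x) \<and>
     (\<forall>g \<in> carrier G. \<forall>h \<in> carrier G. \<forall>x \<in> X. \<phi> (g \<otimes>\<^bsub>G\<^esub> h) x = \<phi> h (\<phi> g x))"

end

theory Submission
  imports Defs
begin

text \<open>
  In coordinates, the product of \<open>\<E>(A)\<close> is \<open>x y = A (x \<circ> y)\<close>, where \<open>\<circ>\<close> is the entrywise
  (Hadamard) product. Let \<open>A\<close> be nonsingular. A linear bijection \<open>\<E>(B) \<rightarrow> \<E>(A)\<close> is a nonsingular
  matrix \<open>g\<close>, and it is an algebra homomorphism as soon as it respects the products of the
  basis vectors (\<open>evo_hom_iff\<close>). For \<open>i \<noteq> j\<close> this condition is \<open>0 = A (g e\<^sub>i \<circ> g e\<^sub>j)\<close>; as \<open>A\<close> is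
  nonsingular, it says that distinct columns of \<open>g\<close> have disjoint supports. For \<open>i = j\<close> it is
  \<open>g B e\<^sub>j = A (g e\<^sub>j \<circ> g e\<^sub>j) = A g\<^bsup>(2)\<^esup> e\<^sub>j\<close>, that is, \<open>B = g\<^bsup>-1\<^esup> A g\<^bsup>(2)\<^esup>\<close>. A nonsingular matrix has
  no zero column, so \<open>n\<close> columns with disjoint supports in a set of \<open>n\<close> rows have one nonzero
  entry each: these matrices are exactly the products \<open>\<sigma> t\<close> (\<open>monomial_group_iff\<close>). Hence
  \<open>\<E>(A) \<cong> \<E>(B)\<close> if and only if \<open>B\<close> lies in the orbit of \<open>A\<close> (\<open>orbit_eq_isomorphic_evo\<close>).

  Every evolution algebra with structure matrix \<open>A\<close> is isomorphic to \<open>\<E>(A)\<close> through coordinates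
  (\<open>evo_isomorphic\<close>). The square of \<open>\<E>(A)\<close> is the column space of \<open>A\<close>, so an idempotent algebra has
  a nonsingular structure matrix (\<open>structure_matrix_in_GL\<close>) and its isomorphism class comes from
  an orbit.

  Disjointness of the column supports of \<open>g\<close> is equivalent to the identity
  \<open>g x \<circ> g y = g\<^bsup>(2)\<^esup> (x \<circ> y)\<close>, from which the closure of these nonsingular matrices under
  products and inverses, \<open>(g h)\<^bsup>(2)\<^esup> = g\<^bsup>(2)\<^esup> h\<^bsup>(2)\<^esup>\<close> and the
  invertibility of \<open>g\<^bsup>(2)\<^esup>\<close> follow without any computation with permutations.
\<close>

abbreviation hadamard :: "nat \<Rightarrow> 'a :: times vec \<Rightarrow> 'a vec \<Rightarrow> 'a vec" where
  "hadamard n x y \<equiv> vec n (\<lambda>i. x $ i * y $ i)"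

abbreviation sq_mat :: "'a :: monoid_mult mat \<Rightarrow> 'a mat" where
  "sq_mat g \<equiv> map_mat (\<lambda>x. x ^ 2) g"

section \<open>Matrices and invertibility\<close>

lemma mult_mat_vec_unit_vec:
  fixes A :: "'a :: field mat"
  assumes "A \<in> carrier_mat m n" and "j < n"
  shows "A *\<^sub>v unit_vec n j = col A j"
  using assms by (intro eq_vecI) auto

lemma mat_eqI_unit_vec:
  fixes A B :: "'a :: field mat"
  assumes A: "A \<in> carrier_mat m n" and B: "B \<in> carrier_mat m n"
    and eq: "\<And>j. j < n \<Longrightarrow> A *\<^sub>v unit_vec n j = B *\<^sub>v unit_vec n j"
  shows "A = B"
proof (rule eq_matI)
  fix i j assume "i < dim_row B" "j < dim_col B"
  then have "i < m" "j < n" using B by auto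
  then have "col A j $ i = col B j $ i"
    using eq[of j] A B by (simp add: mult_mat_vec_unit_vec)
  then show "A $$ (i, j) = B $$ (i, j)" using A B \<open>i < m\<close> \<open>j < n\<close> by simp
qed (use A B in auto)

lemma hadamard_unit_vec:
  assumes "j < n"
  shows "hadamard n (unit_vec n j) (unit_vec n j) = (unit_vec n j :: 'a :: field vec)"
    and "k < n \<Longrightarrow> j \<noteq> k \<Longrightarrow> hadamard n (unit_vec n j) (unit_vec n k) = (0\<^sub>v n :: 'a vec)"
  using assms by (auto intro!: eq_vecI)

text \<open>
  For an arbitrary matrix the squared matrix describes squares of columns only; products of
  different vectors need the disjointness in \<open>hadamard_mult_mat_vec\<close>.
\<close>

lemma sq_mat_mult_unit_vec:
  fixes g :: "'a :: field mat"
  assumes "g \<in> carrier_mat n n" and "j < n"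
  shows "sq_mat g *\<^sub>v unit_vec n j = hadamard n (g *\<^sub>v unit_vec n j) (g *\<^sub>v unit_vec n j)"
proof -
  have "sq_mat g *\<^sub>v unit_vec n j = col (sq_mat g) j"
    by (rule mult_mat_vec_unit_vec) (use assms in auto)
  then show ?thesis
    using assms by (auto simp: mult_mat_vec_unit_vec power2_eq_square intro!: eq_vecI)
qed

lemma GL_group: "Group.group (GL n :: 'a :: field mat monoid)"
  unfolding GL_def by (rule monoid.units_group) (rule ring.is_monoid, rule ring_mat)

lemma GL_simps [simp]: "mult (GL n) = (*)" "one (GL n) = 1\<^sub>m n"
  by (simp_all add: GL_def units_of_mult units_of_one ring_mat_simps)

lemma GL_iff:
  fixes A :: "'a :: field mat"
  shows "A \<in> carrier (GL n) \<longleftrightarrow> A \<in> carrier_mat n n \<and> (\<exists>B \<in> carrier_mat n n. A * B = 1\<^sub>m n)"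
  by (auto simp: GL_def units_of_carrier Units_def ring_mat_simps
      intro: mat_mult_left_right_inverse)

lemma GL_carrier_mat: "A \<in> carrier (GL n) \<Longrightarrow> A \<in> carrier_mat n n"
  by (simp add: GL_iff)

lemma GL_inv:
  fixes A :: "'a :: field mat"
  assumes "A \<in> carrier (GL n)"
  shows "inv\<^bsub>GL n\<^esub> A \<in> carrier (GL n)" and "inv\<^bsub>GL n\<^esub> A \<in> carrier_mat n n"
    and "inv\<^bsub>GL n\<^esub> A * A = 1\<^sub>m n" and "A * inv\<^bsub>GL n\<^esub> A = 1\<^sub>m n"
proof -
  interpret Group.group "GL n :: 'a mat monoid" by (rule GL_group)
  show "inv\<^bsub>GL n\<^esub> A \<in> carrier (GL n)" using assms by simp
  then show "inv\<^bsub>GL n\<^esub> A \<in> carrier_mat n n" by (rule GL_carrier_mat)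
  show "inv\<^bsub>GL n\<^esub> A * A = 1\<^sub>m n" "A * inv\<^bsub>GL n\<^esub> A = 1\<^sub>m n"
    using assms l_inv[of A] r_inv[of A] by simp_all
qed

lemma GL_mult_vec_cancel:
  fixes A :: "'a :: field mat"
  assumes A: "A \<in> carrier (GL n)" and x: "x \<in> carrier_vec n"
  shows "inv\<^bsub>GL n\<^esub> A *\<^sub>v (A *\<^sub>v x) = x" and "A *\<^sub>v (inv\<^bsub>GL n\<^esub> A *\<^sub>v x) = x"
  using GL_inv[OF A] GL_carrier_mat[OF A] x
  by (simp_all flip: assoc_mult_mat_vec)

lemma GL_mult_vec_eq_zero:
  fixes A :: "'a :: field mat"
  assumes A: "A \<in> carrier (GL n)" and x: "x \<in> carrier_vec n" and 0: "A *\<^sub>v x = 0\<^sub>v n"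
  shows "x = 0\<^sub>v n"
proof -
  have "inv\<^bsub>GL n\<^esub> A *\<^sub>v 0\<^sub>v n = 0\<^sub>v n" using GL_inv(2)[OF A] by (auto intro!: eq_vecI)
  then show ?thesis using GL_mult_vec_cancel(1)[OF A x] 0 by simp
qed

lemma GL_mult_left_eq_iff:
  fixes g :: "'a :: field mat"
  assumes g: "g \<in> carrier (GL n)" and B: "B \<in> carrier_mat n n" and C: "C \<in> carrier_mat n n"
  shows "B = inv\<^bsub>GL n\<^esub> g * C \<longleftrightarrow> g * B = C"
proof -
  note gc = GL_carrier_mat[OF g] GL_inv(2)[OF g]
  have "g * (inv\<^bsub>GL n\<^esub> g * C) = C"
    using gc C GL_inv(4)[OF g] by (simp flip: assoc_mult_mat)
  moreover have "inv\<^bsub>GL n\<^esub> g * (g * B) = B"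
    using gc B GL_inv(3)[OF g] by (simp flip: assoc_mult_mat)
  ultimately show ?thesis by auto
qed

text \<open>
  Surjectivity is the form in which both the invertibility of \<open>g\<^bsup>(2)\<^esup>\<close> and the idempotence of
  \<open>\<E>(A)\<close> present themselves. Preimages of the unit vectors are the columns of a right inverse,
  and over a field a right inverse of a square matrix is two-sided.
\<close>

lemma GL_iff_surj:
  fixes A :: "'a :: field mat"
  shows "A \<in> carrier (GL n) \<longleftrightarrow>
    A \<in> carrier_mat n n \<and> (\<forall>y \<in> carrier_vec n. \<exists>x \<in> carrier_vec n. A *\<^sub>v x = y)"
proof (intro iffI conjI ballI)
  assume A: "A \<in> carrier (GL n)"
  then show "A \<in> carrier_mat n n" by (rule GL_carrier_mat)
  fix y :: "'a vec" assume "y \<in> carrier_vec n"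
  then show "\<exists>x \<in> carrier_vec n. A *\<^sub>v x = y"
    using GL_mult_vec_cancel(2)[OF A] GL_inv(2)[OF A] by (metis mult_mat_vec_carrier)
next
  assume *: "A \<in> carrier_mat n n \<and> (\<forall>y \<in> carrier_vec n. \<exists>x \<in> carrier_vec n. A *\<^sub>v x = y)"
  then have "\<forall>j. \<exists>x. x \<in> carrier_vec n \<and> A *\<^sub>v x = unit_vec n j" by (auto simp: Bex_def)
  from choice[OF this] obtain c
    where c: "\<And>j. c j \<in> carrier_vec n" "\<And>j. A *\<^sub>v c j = unit_vec n j" by blast
  define C where "C = mat n n (\<lambda>(i, j). c j $ i)"
  have C: "C \<in> carrier_mat n n" by (simp add: C_def)
  have "A * C = 1\<^sub>m n"
  proof (rule mat_eqI_unit_vec)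
    fix j assume j: "j < n"
    have "C *\<^sub>v unit_vec n j = c j"
      unfolding mult_mat_vec_unit_vec[OF C j] using j c(1)[of j] by (auto simp: C_def)
    then show "(A * C) *\<^sub>v unit_vec n j = 1\<^sub>m n *\<^sub>v unit_vec n j"
      using c(2) by (simp add: assoc_mult_mat_vec[OF conjunct1[OF *] C])
  qed (use * C in auto)
  with * C show "A \<in> carrier (GL n)" by (auto simp: GL_iff)
qed

section \<open>The monomial group\<close>

text \<open>
  Distinct columns have disjoint supports; read along row \<open>i\<close>, each row has at most one nonzero
  entry. Among nonsingular matrices these are the monomial ones.
\<close>

definition disjoint_columns :: "nat \<Rightarrow> 'a :: field mat \<Rightarrow> bool" where
  "disjoint_columns n g \<longleftrightarrow>
     (\<forall>i<n. \<forall>j<n. \<forall>k<n. j \<noteq> k \<longrightarrow> g $$ (i, j) * g $$ (i, k) = 0)"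

lemma disjoint_columns_iff_hadamard:
  fixes g :: "'a :: field mat"
  assumes g: "g \<in> carrier_mat n n"
  shows "disjoint_columns n g \<longleftrightarrow>
    (\<forall>j<n. \<forall>k<n. j \<noteq> k \<longrightarrow> hadamard n (g *\<^sub>v unit_vec n j) (g *\<^sub>v unit_vec n k) = 0\<^sub>v n)"
  using g by (auto simp: disjoint_columns_def mult_mat_vec_unit_vec vec_eq_iff)

text \<open>
  Expanding \<open>(g x)\<^sub>i (g y)\<^sub>i\<close> gives the terms \<open>g\<^sub>i\<^sub>j g\<^sub>i\<^sub>k x\<^sub>j y\<^sub>k\<close>, of which only those with \<open>j = k\<close>
  survive.
\<close>

lemma hadamard_mult_mat_vec:
  fixes g :: "'a :: field mat"
  assumes g: "g \<in> carrier_mat n n" and d: "disjoint_columns n g"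
    and x: "x \<in> carrier_vec n" and y: "y \<in> carrier_vec n"
  shows "hadamard n (g *\<^sub>v x) (g *\<^sub>v y) = sq_mat g *\<^sub>v hadamard n x y"
proof (rule eq_vecI)
  fix i assume "i < dim_vec (sq_mat g *\<^sub>v hadamard n x y)"
  then have i: "i < n" using g by simp
  have "hadamard n (g *\<^sub>v x) (g *\<^sub>v y) $ i =
      (\<Sum>j<n. \<Sum>k<n. (g $$ (i, j) * x $ j) * (g $$ (i, k) * y $ k))"
    using i g x y by (simp add: scalar_prod_def sum_product lessThan_atLeast0)
  also have "\<dots> = (\<Sum>j<n. \<Sum>k<n. if k = j then g $$ (i, j) ^ 2 * (x $ j * y $ j) else 0)"
  proof (intro sum.cong refl)
    fix j k assume "j \<in> {..<n}" "k \<in> {..<n}"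
    then have "k \<noteq> j \<Longrightarrow> g $$ (i, j) * g $$ (i, k) = 0"
      using d i by (auto simp: disjoint_columns_def)
    then show "(g $$ (i, j) * x $ j) * (g $$ (i, k) * y $ k) =
        (if k = j then g $$ (i, j) ^ 2 * (x $ j * y $ j) else 0)"
      by (auto simp: power2_eq_square)
  qed
  also have "\<dots> = (sq_mat g *\<^sub>v hadamard n x y) $ i"
    using i g by (simp add: scalar_prod_def lessThan_atLeast0)
  finally show "hadamard n (g *\<^sub>v x) (g *\<^sub>v y) $ i = (sq_mat g *\<^sub>v hadamard n x y) $ i" .
qed (use g in auto)

text \<open>
  Both sides send \<open>e\<^sub>j\<close> to \<open>g h e\<^sub>j \<circ> g h e\<^sub>j\<close>.
\<close>

lemma sq_mat_mult:
  fixes g h :: "'a :: field mat"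
  assumes g: "g \<in> carrier_mat n n" and d: "disjoint_columns n g" and h: "h \<in> carrier_mat n n"
  shows "sq_mat (g * h) = sq_mat g * sq_mat h"
proof (rule mat_eqI_unit_vec)
  fix j assume j: "j < n"
  have gh: "g * h \<in> carrier_mat n n" using g h by simp
  have "sq_mat (g * h) *\<^sub>v unit_vec n j =
      hadamard n (g *\<^sub>v (h *\<^sub>v unit_vec n j)) (g *\<^sub>v (h *\<^sub>v unit_vec n j))"
    using sq_mat_mult_unit_vec[OF gh j] g h by simp
  also have "\<dots> = sq_mat g *\<^sub>v (sq_mat h *\<^sub>v unit_vec n j)"
    using h by (simp add: hadamard_mult_mat_vec[OF g d] sq_mat_mult_unit_vec[OF h j])
  also have "\<dots> = (sq_mat g * sq_mat h) *\<^sub>v unit_vec n j"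
    using g h by (intro assoc_mult_mat_vec[symmetric]) auto
  finally show "sq_mat (g * h) *\<^sub>v unit_vec n j = (sq_mat g * sq_mat h) *\<^sub>v unit_vec n j" .
qed (use g h in auto)

text \<open>
  With \<open>h = g\<^bsup>-1\<^esup>\<close> and the all-ones vector \<open>u\<close>, the vector \<open>y = y \<circ> u = g (h y) \<circ> g (h u)\<close> is the
  image of \<open>h y \<circ> h u\<close> under \<open>g\<^bsup>(2)\<^esup>\<close>, so \<open>g\<^bsup>(2)\<^esup>\<close> is surjective.
\<close>

lemma sq_mat_in_GL:
  fixes g :: "'a :: field mat"
  assumes g: "g \<in> carrier (GL n)" and d: "disjoint_columns n g"
  shows "sq_mat g \<in> carrier (GL n)"
  unfolding GL_iff_surj
proof (intro conjI ballI)
  note gc = GL_carrier_mat[OF g]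
  show "sq_mat g \<in> carrier_mat n n" using gc by simp
  fix y :: "'a vec" assume y: "y \<in> carrier_vec n"
  define u where "u = (vec n (\<lambda>_. 1) :: 'a vec)"
  let ?h = "inv\<^bsub>GL n\<^esub> g"
  have u: "u \<in> carrier_vec n" by (simp add: u_def)
  have "sq_mat g *\<^sub>v hadamard n (?h *\<^sub>v y) (?h *\<^sub>v u) =
      hadamard n (g *\<^sub>v (?h *\<^sub>v y)) (g *\<^sub>v (?h *\<^sub>v u))"
    using GL_inv(2)[OF g] y u by (simp add: hadamard_mult_mat_vec[OF gc d])
  also have "\<dots> = hadamard n y u" by (simp only: GL_mult_vec_cancel(2)[OF g] y u)
  also have "\<dots> = y" using y by (auto simp: u_def)
  finally show "\<exists>x \<in> carrier_vec n. sq_mat g *\<^sub>v x = y" by (intro bexI) auto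
qed

lemma disjoint_columns_mult:
  fixes g h :: "'a :: field mat"
  assumes g: "g \<in> carrier_mat n n" "disjoint_columns n g"
    and h: "h \<in> carrier_mat n n" "disjoint_columns n h"
  shows "disjoint_columns n (g * h)"
proof -
  have gh: "g * h \<in> carrier_mat n n" using g h by simp
  have 0: "sq_mat g *\<^sub>v 0\<^sub>v n = 0\<^sub>v n" using g by (auto intro!: eq_vecI)
  have "hadamard n (g * h *\<^sub>v unit_vec n j) (g * h *\<^sub>v unit_vec n k) = 0\<^sub>v n"
    if "j < n" "k < n" "j \<noteq> k" for j k
  proof -
    have "hadamard n (g * h *\<^sub>v unit_vec n j) (g * h *\<^sub>v unit_vec n k) =
        sq_mat g *\<^sub>v hadamard n (h *\<^sub>v unit_vec n j) (h *\<^sub>v unit_vec n k)"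
      using h by (simp add: assoc_mult_mat_vec[OF g(1) h(1)] hadamard_mult_mat_vec[OF g])
    also have "hadamard n (h *\<^sub>v unit_vec n j) (h *\<^sub>v unit_vec n k) = 0\<^sub>v n"
      using h(2) that unfolding disjoint_columns_iff_hadamard[OF h(1)] by blast
    finally show ?thesis using 0 by simp
  qed
  then show ?thesis by (simp add: disjoint_columns_iff_hadamard[OF gh])
qed

text \<open>
  For \<open>h = g\<^bsup>-1\<^esup>\<close> and \<open>j \<noteq> k\<close>, the matrix \<open>g\<^bsup>(2)\<^esup>\<close> maps \<open>h e\<^sub>j \<circ> h e\<^sub>k\<close> to \<open>e\<^sub>j \<circ> e\<^sub>k = 0\<close>, and it is
  injective.
\<close>

lemma disjoint_columns_inv:
  fixes g :: "'a :: field mat"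
  assumes g: "g \<in> carrier (GL n)" and d: "disjoint_columns n g"
  shows "disjoint_columns n (inv\<^bsub>GL n\<^esub> g)"
proof -
  let ?h = "inv\<^bsub>GL n\<^esub> g"
  have h: "?h \<in> carrier_mat n n" by (rule GL_inv(2)[OF g])
  have "hadamard n (?h *\<^sub>v unit_vec n j) (?h *\<^sub>v unit_vec n k) = 0\<^sub>v n"
    if jk: "j < n" "k < n" "j \<noteq> k" for j k
  proof (rule GL_mult_vec_eq_zero[OF sq_mat_in_GL[OF g d]])
    have "sq_mat g *\<^sub>v hadamard n (?h *\<^sub>v unit_vec n j) (?h *\<^sub>v unit_vec n k) =
        hadamard n (g *\<^sub>v (?h *\<^sub>v unit_vec n j)) (g *\<^sub>v (?h *\<^sub>v unit_vec n k))"
      using h by (simp add: hadamard_mult_mat_vec[OF GL_carrier_mat[OF g] d])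
    also have "\<dots> = hadamard n (unit_vec n j) (unit_vec n k)"
      by (simp only: GL_mult_vec_cancel(2)[OF g] unit_vec_carrier)
    also have "\<dots> = 0\<^sub>v n" by (rule hadamard_unit_vec(2)) (use jk in auto)
    finally show "sq_mat g *\<^sub>v hadamard n (?h *\<^sub>v unit_vec n j) (?h *\<^sub>v unit_vec n k) = 0\<^sub>v n" .
  qed simp
  then show ?thesis by (simp add: disjoint_columns_iff_hadamard[OF h])
qed

lemma perm_mat_mult_col:
  fixes t :: "'a :: field mat"
  assumes t: "t \<in> carrier_mat n n" "diagonal_mat t" and ij: "i < n" "j < n"
  shows "(perm_mat n \<sigma> * t) $$ (i, j) = (if i = \<sigma> j then t $$ (j, j) else 0)"
proof -
  have *: "t $$ (k, j) = (if k = j then t $$ (j, j) else 0)" if "k < n" for k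
    using t ij that by (simp add: diagonal_mat_def)
  have "(perm_mat n \<sigma> * t) $$ (i, j) =
      (\<Sum>k<n. (if i = \<sigma> k then 1 else 0) * t $$ (k, j))"
    using t(1) ij by (simp add: perm_mat_def scalar_prod_def lessThan_atLeast0)
  also have "\<dots> = (\<Sum>k<n. if k = j then (if i = \<sigma> j then t $$ (j, j) else 0) else 0)"
    by (intro sum.cong refl) (subst *, simp_all)
  finally show ?thesis using ij by simp
qed

lemma perm_mats_GL:
  assumes "s \<in> perm_mats n"
  shows "s \<in> carrier (GL n :: 'a :: field mat monoid)"
proof -
  from assms obtain \<sigma> where \<sigma>: "\<sigma> permutes {..<n}" and s: "s = perm_mat n \<sigma>"
    by (auto simp: perm_mats_def)
  have "s * perm_mat n (inv_into UNIV \<sigma>) = 1\<^sub>m n"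
  proof (rule eq_matI)
    fix i j assume "i < dim_row (1\<^sub>m n :: 'a mat)" "j < dim_col (1\<^sub>m n :: 'a mat)"
    then have ij: "i < n" "j < n" by auto
    then have "inv_into UNIV \<sigma> j < n" using permutes_in_image[OF permutes_inv[OF \<sigma>]] by auto
    moreover have "(s * perm_mat n (inv_into UNIV \<sigma>)) $$ (i, j) =
        (\<Sum>k<n. (if i = \<sigma> k then 1 else 0) * (if k = inv_into UNIV \<sigma> j then 1 else 0))"
      using ij by (simp add: s perm_mat_def scalar_prod_def lessThan_atLeast0)
    moreover have "\<dots> = (\<Sum>k<n. if k = inv_into UNIV \<sigma> j then (if i = j then 1 else 0) else 0)"
      using permutes_inverses[OF \<sigma>] by (intro sum.cong) auto
    ultimately show "(s * perm_mat n (inv_into UNIV \<sigma>)) $$ (i, j) = 1\<^sub>m n $$ (i, j)" using ij by simp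
  qed (auto simp: s perm_mat_def)
  moreover have "s \<in> carrier_mat n n" "perm_mat n (inv_into UNIV \<sigma>) \<in> carrier_mat n n"
    by (auto simp: s perm_mat_def)
  ultimately show ?thesis by (auto simp: GL_iff)
qed

lemma perm_mats_disjoint_columns:
  assumes "s \<in> perm_mats n"
  shows "disjoint_columns n s"
proof -
  from assms obtain \<sigma> where \<sigma>: "\<sigma> permutes {..<n}" and s: "s = perm_mat n \<sigma>"
    by (auto simp: perm_mats_def)
  show ?thesis using permutes_inj[OF \<sigma>] by (auto simp: s disjoint_columns_def perm_mat_def inj_def)
qed

lemma sq_mat_perm_mats: "s \<in> perm_mats n \<Longrightarrow> sq_mat s = s"
  by (auto simp: perm_mats_def perm_mat_def)

lemma torus_disjoint_columns: "t \<in> torus n \<Longrightarrow> disjoint_columns n t"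
  by (auto simp: torus_def diagonal_mat_def disjoint_columns_def dest!: GL_carrier_mat) metis

lemma sq_mat_torus:
  fixes t :: "'a :: field mat"
  assumes "t \<in> torus n"
  shows "sq_mat t = t * t"
proof (rule mat_eqI_unit_vec)
  show tc: "sq_mat t \<in> carrier_mat n n" "t * t \<in> carrier_mat n n"
    using assms by (auto simp: torus_def dest!: GL_carrier_mat)
next
  fix j assume j: "j < n"
  have t: "t \<in> carrier_mat n n" "diagonal_mat t" 
    using assms by (auto simp: torus_def dest!: GL_carrier_mat)
  have "t *\<^sub>v unit_vec n j = t $$ (j, j) \<cdot>\<^sub>v unit_vec n j"
    using t j by (auto simp: mult_mat_vec_unit_vec[OF t(1) j] diagonal_mat_def)
  then show "sq_mat t *\<^sub>v unit_vec n j = t * t *\<^sub>v unit_vec n j"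
    using t j by (auto simp: sq_mat_mult_unit_vec[OF t(1) j] mult_mat_vec intro!: eq_vecI)
qed

text \<open>
  This replaces factorisations \<open>\<sigma> t\<close> by a condition on entries. For the converse direction, a
  nonsingular \<open>g\<close> has a nonzero entry in each column \<open>j\<close>, say in row \<open>r j\<close>. Disjointness makes \<open>r\<close>
  injective, hence a permutation of the row indices, and the entries off the positions
  \<open>(r j, j)\<close> vanish because their row already contains a nonzero entry.
\<close>

lemma monomial_group_iff:
  fixes g :: "'a :: field mat"
  shows "g \<in> carrier (monomial_group n) \<longleftrightarrow> g \<in> carrier (GL n) \<and> disjoint_columns n g"
proof
  assume "g \<in> carrier (monomial_group n)"
  then obtain s t where st: "s \<in> perm_mats n" "t \<in> torus n" and g: "g = s * t"
    by (auto simp: monomial_group_def)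
  interpret G: Group.group "GL n :: 'a mat monoid" by (rule GL_group)
  have GL: "s \<in> carrier (GL n)" "t \<in> carrier (GL n)"
    using st by (auto simp: perm_mats_GL torus_def)
  then have "g \<in> carrier (GL n)" using G.m_closed[of s t] by (simp add: g)
  moreover have "disjoint_columns n g"
    unfolding g using GL st
    by (intro disjoint_columns_mult perm_mats_disjoint_columns torus_disjoint_columns GL_carrier_mat)
  ultimately show "g \<in> carrier (GL n) \<and> disjoint_columns n g" by blast
next
  assume *: "g \<in> carrier (GL n) \<and> disjoint_columns n g"
  then have GL: "g \<in> carrier (GL n)" and d: "disjoint_columns n g" by auto
  note gc = GL_carrier_mat[OF GL]
  have "\<exists>i<n. g $$ (i, j) \<noteq> 0" if j: "j < n" for j
  proof (rule ccontr)
    assume "\<not> (\<exists>i<n. g $$ (i, j) \<noteq> 0)"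
    then have "g *\<^sub>v unit_vec n j = 0\<^sub>v n" using gc j by (auto simp: mult_mat_vec_unit_vec)
    from GL_mult_vec_eq_zero[OF GL unit_vec_carrier this]
    have "(unit_vec n j :: 'a vec) = 0\<^sub>v n" .
    then have "(unit_vec n j :: 'a vec) $ j = 0" using j by simp
    then show False using j by simp
  qed
  then obtain r where r: "\<And>j. j < n \<Longrightarrow> r j < n \<and> g $$ (r j, j) \<noteq> 0" by metis
  \<comment> \<open>A permutation of \<open>{..<n}\<close> fixes all other numbers, so \<open>r\<close> is extended by the identity.\<close>
  define \<sigma> where "\<sigma> j = (if j < n then r j else j)" for j
  have inj: "inj_on r {..<n}"
  proof (rule inj_onI, rule ccontr)
    fix j k assume "j \<in> {..<n}" "k \<in> {..<n}" "r j = r k" "j \<noteq> k"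
    then show False using r[of j] r[of k] d by (auto simp: disjoint_columns_def)
  qed
  moreover have "r ` {..<n} \<subseteq> {..<n}" using r by auto
  ultimately have img: "r ` {..<n} = {..<n}" by (simp add: endo_inj_surj)
  have "bij_betw \<sigma> {..<n} {..<n}"
    using inj img by (subst bij_betw_cong[of _ _ r]) (auto simp: \<sigma>_def bij_betw_def)
  then have \<sigma>: "\<sigma> permutes {..<n}" by (rule bij_imp_permutes) (simp add: \<sigma>_def)
  define s where "s = (perm_mat n \<sigma> :: 'a mat)"
  define t where "t = mat n n (\<lambda>(i, j). if i = j then g $$ (r j, j) else 0)"
  have s: "s \<in> perm_mats n" using \<sigma> by (auto simp: s_def perm_mats_def)
  have t: "t \<in> carrier_mat n n" "diagonal_mat t" by (auto simp: t_def diagonal_mat_def)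
  have gst: "g = s * t"
  proof (rule eq_matI)
    fix i j assume "i < dim_row (s * t)" "j < dim_col (s * t)"
    then have ij: "i < n" "j < n" using t by (auto simp: s_def perm_mat_def)
    have "g $$ (i, j) = 0" if ne: "i \<noteq> r j"
    proof -
      from img ij(1) obtain k where k: "k < n" "i = r k" by (metis imageE lessThan_iff)
      with ne have "j \<noteq> k" by auto
      then have "g $$ (i, j) * g $$ (i, k) = 0"
        using d ij k by (auto simp: disjoint_columns_def)
      then show ?thesis using r[of k] k by simp
    qed
    then show "g $$ (i, j) = (s * t) $$ (i, j)"
      using ij by (simp add: s_def perm_mat_mult_col[OF t] \<sigma>_def) (auto simp: t_def)
  qed (use gc t in \<open>auto simp: s_def perm_mat_def\<close>)
  \<comment> \<open>Being \<open>\<sigma>\<^bsup>-1\<^esup> g\<close>, the diagonal factor is nonsingular.\<close>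
  interpret G: Group.group "GL n :: 'a mat monoid" by (rule GL_group)
  have sGL: "s \<in> carrier (GL n)" using s by (rule perm_mats_GL)
  have "t = inv\<^bsub>GL n\<^esub> s * g"
    using GL_mult_left_eq_iff[OF sGL t(1) gc] gst by simp
  moreover have "inv\<^bsub>GL n\<^esub> s * g \<in> carrier (GL n)"
    using G.m_closed[OF GL_inv(1)[OF sGL] GL] by simp
  ultimately have "t \<in> torus n" using t by (simp add: torus_def)
  with s gst show "g \<in> carrier (monomial_group n)" by (auto simp: monomial_group_def)
qed

lemma monomial_subgroup:
  "subgroup (carrier (monomial_group n)) (GL n :: 'a :: field mat monoid)"
proof (rule group.subgroupI[OF GL_group])
  interpret G: Group.group "GL n :: 'a mat monoid" by (rule GL_group)
  show "carrier (monomial_group n) \<subseteq> carrier (GL n :: 'a mat monoid)"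
    by (auto simp: monomial_group_iff)
  have "1\<^sub>m n \<in> carrier (GL n :: 'a mat monoid)" using G.one_closed by simp
  then have "1\<^sub>m n \<in> carrier (monomial_group n :: 'a mat monoid)"
    by (simp add: monomial_group_iff disjoint_columns_def)
  then show "carrier (monomial_group n) \<noteq> ({} :: 'a mat set)" by blast
  fix g h :: "'a mat" assume g: "g \<in> carrier (monomial_group n)"
  then show "inv\<^bsub>GL n\<^esub> g \<in> carrier (monomial_group n)"
    by (simp add: monomial_group_iff disjoint_columns_inv GL_inv(1))
  assume h: "h \<in> carrier (monomial_group n)"
  show "g \<otimes>\<^bsub>GL n\<^esub> h \<in> carrier (monomial_group n)"
    using g h G.m_closed[of g h] by (auto simp: monomial_group_iff intro: disjoint_columns_mult GL_carrier_mat)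
qed

lemma evo_act_right_action:
  "right_action (monomial_group n) (carrier (GL n)) (evo_act n :: 'a :: field mat \<Rightarrow> _)"
  unfolding right_action_def
proof (intro conjI ballI)
  interpret G: Group.group "GL n :: 'a mat monoid" by (rule GL_group)
  show "Group.group (monomial_group n :: 'a mat monoid)"
    using G.subgroup_imp_group[OF monomial_subgroup] by (simp add: monomial_group_def)
  fix A :: "'a mat" assume A: "A \<in> carrier (GL n)"
  note Ac = GL_carrier_mat[OF A]
  have "sq_mat (1\<^sub>m n) = (1\<^sub>m n :: 'a mat)" by (rule eq_matI) auto
  moreover have "inv\<^bsub>GL n\<^esub> (1\<^sub>m n) = (1\<^sub>m n :: 'a mat)" using G.inv_one by simp
  ultimately show "evo_act n \<one>\<^bsub>monomial_group n\<^esub> A = A"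
    using Ac by (simp add: evo_act_def monomial_group_def)
  fix g :: "'a mat" assume "g \<in> carrier (monomial_group n)"
  then have g: "g \<in> carrier (GL n)" "disjoint_columns n g" by (auto simp: monomial_group_iff)
  note gs = sq_mat_in_GL[OF g]
  have "inv\<^bsub>GL n\<^esub> g \<otimes>\<^bsub>GL n\<^esub> A \<otimes>\<^bsub>GL n\<^esub> sq_mat g \<in> carrier (GL n)"
    using g A gs by (intro G.m_closed G.inv_closed)
  then show "evo_act n g A \<in> carrier (GL n)" by (simp add: evo_act_def)
  fix h :: "'a mat" assume "h \<in> carrier (monomial_group n)"
  then have h: "h \<in> carrier (GL n)" "disjoint_columns n h" by (auto simp: monomial_group_iff)
  note hs = sq_mat_in_GL[OF h]
  have "inv\<^bsub>GL n\<^esub> (g \<otimes>\<^bsub>GL n\<^esub> h) \<otimes>\<^bsub>GL n\<^esub> A \<otimes>\<^bsub>GL n\<^esub> (sq_mat g \<otimes>\<^bsub>GL n\<^esub> sq_mat h) =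
      inv\<^bsub>GL n\<^esub> h \<otimes>\<^bsub>GL n\<^esub> (inv\<^bsub>GL n\<^esub> g \<otimes>\<^bsub>GL n\<^esub> A \<otimes>\<^bsub>GL n\<^esub> sq_mat g) \<otimes>\<^bsub>GL n\<^esub> sq_mat h"
    using g(1) h(1) A gs hs
    by (simp add: G.inv_mult_group G.m_assoc del: GL_simps)
  then show "evo_act n (g \<otimes>\<^bsub>monomial_group n\<^esub> h) A = evo_act n h (evo_act n g A)"
    using sq_mat_mult[OF GL_carrier_mat[OF g(1)] g(2) GL_carrier_mat[OF h(1)]]
    by (simp add: evo_act_def monomial_group_def)
qed

lemma evo_act_perm_torus:
  fixes A :: "'a :: field mat"
  assumes s: "s \<in> perm_mats n" and t: "t \<in> torus n" and A: "A \<in> carrier (GL n)"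
  shows "evo_act n (s * t) A = inv\<^bsub>GL n\<^esub> t * inv\<^bsub>GL n\<^esub> s * A * s * (t * t)"
proof -
  interpret G: Group.group "GL n :: 'a mat monoid" by (rule GL_group)
  have GL: "s \<in> carrier (GL n)" "t \<in> carrier (GL n)"
    using s t by (auto simp: perm_mats_GL torus_def)
  have "sq_mat (s * t) = s * (t * t)"
    using sq_mat_mult[OF GL_carrier_mat[OF GL(1)] perm_mats_disjoint_columns[OF s]
        GL_carrier_mat[OF GL(2)]] s t
    by (simp add: sq_mat_perm_mats sq_mat_torus)
  moreover have "inv\<^bsub>GL n\<^esub> (s \<otimes>\<^bsub>GL n\<^esub> t) \<otimes>\<^bsub>GL n\<^esub> A \<otimes>\<^bsub>GL n\<^esub> (s \<otimes>\<^bsub>GL n\<^esub> (t \<otimes>\<^bsub>GL n\<^esub> t)) =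
      inv\<^bsub>GL n\<^esub> t \<otimes>\<^bsub>GL n\<^esub> inv\<^bsub>GL n\<^esub> s \<otimes>\<^bsub>GL n\<^esub> A \<otimes>\<^bsub>GL n\<^esub> s \<otimes>\<^bsub>GL n\<^esub> (t \<otimes>\<^bsub>GL n\<^esub> t)"
    using GL A by (simp add: G.inv_mult_group G.m_assoc del: GL_simps)
  ultimately show ?thesis by (simp add: evo_act_def)
qed

section \<open>Isomorphisms and bases\<close>

lemma algebra_isomorphic_refl: "algebra_isomorphic K V V"
  unfolding algebra_isomorphic_def
  by (intro exI[of _ "\<lambda>x. x"] conjI iso_set_refl) (simp add: LinearCombinations.module_hom_def)

lemma algebra_isomorphic_trans:
  assumes "algebra_isomorphic K U V" and "algebra_isomorphic K V W"
  shows "algebra_isomorphic K U W"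
proof -
  from assms obtain f g where fg: "f \<in> LinearCombinations.module_hom K U V" "f \<in> iso U V"
      "g \<in> LinearCombinations.module_hom K V W" "g \<in> iso V W"
    by (auto simp: algebra_isomorphic_def)
  have "g \<circ> f \<in> LinearCombinations.module_hom K U W"
    using fg(1,3) by (auto simp: LinearCombinations.module_hom_def Pi_iff)
  with iso_set_trans[OF fg(2,4)] show ?thesis by (auto simp: algebra_isomorphic_def)
qed

lemma algebra_isomorphic_sym:
  assumes V: "nonassoc_algebra K V" and iso: "algebra_isomorphic K V W"
  shows "algebra_isomorphic K W V"
proof -
  interpret V: nonassoc_algebra K V by (rule V)
  from iso obtain f where f: "f \<in> LinearCombinations.module_hom K V W" "f \<in> iso V W"
    by (auto simp: algebra_isomorphic_def)
  have bij: "bij_betw f (carrier V) (carrier W)" and hom: "f \<in> hom V W"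
    using f(2) by (auto simp: iso_def)
  define g where "g = inv_into (carrier V) f"
  have g: "bij_betw g (carrier W) (carrier V)"
    unfolding g_def by (rule bij_betw_inv_into[OF bij])
  have gf: "g (f x) = x" if "x \<in> carrier V" for x
    unfolding g_def using bij that by (rule bij_betw_inv_into_left)
  have ex: "\<exists>x \<in> carrier V. y = f x" if "y \<in> carrier W" for y
    using bij that unfolding bij_betw_def by blast
  have gc: "g y \<in> carrier V" if "y \<in> carrier W" for y
    using g that by (auto simp: bij_betw_def)
  have "g \<in> LinearCombinations.module_hom K W V"
    unfolding LinearCombinations.module_hom_def
  proof (intro CollectI conjI allI impI)
    show "g \<in> carrier W \<rightarrow> carrier V" using gc by blast
  next
    fix y z assume yz: "y \<in> carrier W \<and> z \<in> carrier W"
    obtain u where "u \<in> carrier V" "y = f u" using ex[of y] yz by auto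
    moreover obtain v where "v \<in> carrier V" "z = f v" using ex[of z] yz by auto
    ultimately show "g (y \<oplus>\<^bsub>W\<^esub> z) = g y \<oplus>\<^bsub>V\<^esub> g z"
      by (simp add: gf flip: LinearCombinations.module_hom_add[OF f(1)])
  next
    fix c y assume cy: "c \<in> carrier K \<and> y \<in> carrier W"
    obtain u where "u \<in> carrier V" "y = f u" using ex[of y] cy by auto
    with cy show "g (c \<odot>\<^bsub>W\<^esub> y) = c \<odot>\<^bsub>V\<^esub> g y"
      by (simp add: gf flip: LinearCombinations.module_hom_smult[OF f(1)])
  qed
  moreover have "g \<in> hom W V"
  proof (rule homI)
    fix y z assume yz: "y \<in> carrier W" "z \<in> carrier W"
    obtain u where "u \<in> carrier V" "y = f u" using ex[OF yz(1)] by auto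
    moreover obtain v where "v \<in> carrier V" "z = f v" using ex[OF yz(2)] by auto
    ultimately show "g (y \<otimes>\<^bsub>W\<^esub> z) = g y \<otimes>\<^bsub>V\<^esub> g z"
      by (simp add: gf V.mult_closed flip: hom_mult[OF hom])
  qed (rule gc)
  ultimately show ?thesis using g by (auto simp: algebra_isomorphic_def iso_def)
qed

lemma natural_basisD:
  assumes "nonassoc_algebra class_ring V" and "natural_basis n V e"
  shows "\<And>i. i < n \<Longrightarrow> e i \<in> carrier V"
    and "LinearCombinations.module.span class_ring V (e ` {..<n}) = carrier V"
    and "\<not> LinearCombinations.module.lin_dep class_ring V (e ` {..<n})"
    and "inj_on e {..<n}"
    and "\<And>i j. i < n \<Longrightarrow> j < n \<Longrightarrow> i \<noteq> j \<Longrightarrow> e i \<otimes>\<^bsub>V\<^esub> e j = \<zero>\<^bsub>V\<^esub>"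
proof -
  interpret V: nonassoc_algebra class_ring V by (rule assms)
  show "\<And>i. i < n \<Longrightarrow> e i \<in> carrier V" "V.span (e ` {..<n}) = carrier V"
      "V.lin_indpt (e ` {..<n})" "inj_on e {..<n}"
      "\<And>i j. i < n \<Longrightarrow> j < n \<Longrightarrow> i \<noteq> j \<Longrightarrow> e i \<otimes>\<^bsub>V\<^esub> e j = \<zero>\<^bsub>V\<^esub>"
    using assms(2) by (auto simp: natural_basis_def V.basis_def)
qed

text \<open>
  The set of vectors on which two linear maps agree, and the image of a linear map, are
  submodules; agreement and surjectivity are thereby checked on basis vectors.
\<close>

lemma submodule_containing_basis:
  assumes V: "nonassoc_algebra class_ring V" and e: "natural_basis n V e"
    and S: "submodule class_ring S V" and sub: "\<And>i. i < n \<Longrightarrow> e i \<in> S"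
  shows "S = carrier V"
proof -
  interpret V: nonassoc_algebra class_ring V by (rule V)
  have "V.span (e ` {..<n}) \<subseteq> S"
    by (rule V.span_is_subset[OF _ S]) (use sub in auto)
  moreover have "S \<subseteq> carrier V" using S by (rule submodule.subset)
  ultimately show ?thesis using natural_basisD(2)[OF V e] by auto
qed

lemma module_hom_eq_on_basis:
  assumes V: "nonassoc_algebra class_ring V" and e: "natural_basis n V e"
    and W: "nonassoc_algebra class_ring W"
    and f: "f \<in> LinearCombinations.module_hom class_ring V W" and g: "g \<in> LinearCombinations.module_hom class_ring V W"
    and eq: "\<And>i. i < n \<Longrightarrow> f (e i) = g (e i)" and x: "x \<in> carrier V"
  shows "f x = g x"
proof -
  interpret V: nonassoc_algebra class_ring V by (rule V)
  interpret W: nonassoc_algebra class_ring W by (rule W)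
  interpret f: mod_hom class_ring V W f by unfold_locales (rule f)
  interpret g: mod_hom class_ring V W g by unfold_locales (rule g)
  have "submodule class_ring {x \<in> carrier V. f x = g x} V"
    by (rule submodule.intro) (auto intro: V.module_axioms)
  from submodule_containing_basis[OF V e this] have "{x \<in> carrier V. f x = g x} = carrier V"
    using natural_basisD(1)[OF V e] eq by auto
  with x show ?thesis by blast
qed

text \<open>
  Both sides of \<open>f (x y) = f x f y\<close> are linear in \<open>y\<close> when \<open>x\<close> is a basis vector, and then linear in
  \<open>x\<close> for an arbitrary \<open>y\<close>.
\<close>

lemma hom_if_multiplicative_on_basis:
  assumes V: "nonassoc_algebra class_ring V" and e: "natural_basis n V e"
    and W: "nonassoc_algebra class_ring W" and f: "f \<in> LinearCombinations.module_hom class_ring V W"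
    and mult: "\<And>i j. i < n \<Longrightarrow> j < n \<Longrightarrow> f (e i \<otimes>\<^bsub>V\<^esub> e j) = f (e i) \<otimes>\<^bsub>W\<^esub> f (e j)"
  shows "f \<in> hom V W"
proof (rule homI)
  interpret V: nonassoc_algebra class_ring V by (rule V)
  interpret W: nonassoc_algebra class_ring W by (rule W)
  interpret f: mod_hom class_ring V W f by unfold_locales (rule f)
  note simps = V.mult_closed V.mult_add_left V.mult_add_right V.mult_smult_left V.mult_smult_right
    W.mult_closed W.mult_add_left W.mult_add_right W.mult_smult_left W.mult_smult_right
    f.f_add f.f_smult
  have left: "f (e i \<otimes>\<^bsub>V\<^esub> y) = f (e i) \<otimes>\<^bsub>W\<^esub> f y" if i: "i < n" and y: "y \<in> carrier V" for i y
  proof (rule module_hom_eq_on_basis[OF V e W _ _ _ y])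
    show "(\<lambda>y. f (e i \<otimes>\<^bsub>V\<^esub> y)) \<in> LinearCombinations.module_hom class_ring V W"
        "(\<lambda>y. f (e i) \<otimes>\<^bsub>W\<^esub> f y) \<in> LinearCombinations.module_hom class_ring V W"
      using natural_basisD(1)[OF V e i] by (auto simp: LinearCombinations.module_hom_def simps)
  qed (use mult i in auto)
  show "f (x \<otimes>\<^bsub>V\<^esub> y) = f x \<otimes>\<^bsub>W\<^esub> f y" if x: "x \<in> carrier V" and y: "y \<in> carrier V" for x y
  proof (rule module_hom_eq_on_basis[OF V e W _ _ _ x])
    show "(\<lambda>x. f (x \<otimes>\<^bsub>V\<^esub> y)) \<in> LinearCombinations.module_hom class_ring V W"
        "(\<lambda>x. f x \<otimes>\<^bsub>W\<^esub> f y) \<in> LinearCombinations.module_hom class_ring V W"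
      using y by (auto simp: LinearCombinations.module_hom_def simps)
  qed (use left y in auto)
  show "\<And>x. x \<in> carrier V \<Longrightarrow> f x \<in> carrier W" by simp
qed

section \<open>Coordinates with respect to a natural basis\<close>

definition lin_combination :: "nat \<Rightarrow> ('a :: field, 'v) module \<Rightarrow> (nat \<Rightarrow> 'v) \<Rightarrow> 'a vec \<Rightarrow> 'v" where
  "lin_combination n V e x = (\<Oplus>\<^bsub>V\<^esub>i\<in>{..<n}. x $ i \<odot>\<^bsub>V\<^esub> e i)"

text \<open>
  The structure matrix \<open>A\<close> is arbitrary here because the vector space underlying \<open>evo n A\<close> does
  not depend on it.
\<close>

lemma lin_combination_module_hom:
  fixes V :: "('a :: field, 'v) module"
  assumes V: "nonassoc_algebra class_ring V" and e: "natural_basis n V e"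
  shows "lin_combination n V e \<in> LinearCombinations.module_hom class_ring (evo n A) V"
proof -
  interpret V: nonassoc_algebra class_ring V by (rule V)
  note ec = natural_basisD(1)[OF V e]
  have summand: "(\<lambda>i. x $ i \<odot>\<^bsub>V\<^esub> e i) \<in> {..<n} \<rightarrow> carrier V" for x
    using ec by auto
  show ?thesis
    unfolding LinearCombinations.module_hom_def
  proof (intro CollectI conjI allI impI)
    show "lin_combination n V e \<in> carrier (evo n A) \<rightarrow> carrier V"
      using summand by (auto simp: lin_combination_def)
  next
    fix x y assume "x \<in> carrier (evo n A) \<and> y \<in> carrier (evo n A)"
    then have xy: "x \<in> carrier_vec n" "y \<in> carrier_vec n" by auto
    have "lin_combination n V e (x + y) = (\<Oplus>\<^bsub>V\<^esub>i\<in>{..<n}. x $ i \<odot>\<^bsub>V\<^esub> e i \<oplus>\<^bsub>V\<^esub> y $ i \<odot>\<^bsub>V\<^esub> e i)"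
      unfolding lin_combination_def
      using xy ec V.smult_l_distr by (intro V.finsum_cong') auto
    also have "\<dots> = lin_combination n V e x \<oplus>\<^bsub>V\<^esub> lin_combination n V e y"
      unfolding lin_combination_def by (rule V.finsum_addf[OF summand summand])
    finally show "lin_combination n V e (x \<oplus>\<^bsub>evo n A\<^esub> y) =
        lin_combination n V e x \<oplus>\<^bsub>V\<^esub> lin_combination n V e y" by simp
  next
    fix c :: 'a and x :: "'a vec" assume "c \<in> carrier class_ring \<and> x \<in> carrier (evo n A)"
    then have x: "x \<in> carrier_vec n" by auto
    have "lin_combination n V e (c \<cdot>\<^sub>v x) = (\<Oplus>\<^bsub>V\<^esub>i\<in>{..<n}. c \<odot>\<^bsub>V\<^esub> (x $ i \<odot>\<^bsub>V\<^esub> e i))"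
      unfolding lin_combination_def
      using x ec V.smult_assoc1 by (intro V.finsum_cong') auto
    also have "\<dots> = c \<odot>\<^bsub>V\<^esub> lin_combination n V e x"
      unfolding lin_combination_def by (rule V.finsum_smult[symmetric]) (use summand in auto)
    finally show "lin_combination n V e (c \<odot>\<^bsub>evo n A\<^esub> x) = c \<odot>\<^bsub>V\<^esub> lin_combination n V e x"
      by simp
  qed
qed

lemma lin_combination_unit_vec:
  assumes V: "nonassoc_algebra class_ring V" and e: "natural_basis n V e" and j: "j < n"
  shows "lin_combination n V e (unit_vec n j) = e j"
proof -
  interpret V: nonassoc_algebra class_ring V by (rule V)
  note ec = natural_basisD(1)[OF V e]
  have one: "1 \<odot>\<^bsub>V\<^esub> v = v" and zero: "0 \<odot>\<^bsub>V\<^esub> v = \<zero>\<^bsub>V\<^esub>" if "v \<in> carrier V" for v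
    using V.smult_one[OF that] V.lmult_0[OF that] by simp_all
  have "lin_combination n V e (unit_vec n j) = (\<Oplus>\<^bsub>V\<^esub>i\<in>{..<n}. if j = i then e i else \<zero>\<^bsub>V\<^esub>)"
    unfolding lin_combination_def using j ec one zero by (intro V.finsum_cong') auto
  also have "\<dots> = e j"
    using j ec by (intro V.add.finprod_singleton) auto
  finally show ?thesis .
qed

text \<open>
  The image contains the basis vectors and is a submodule, and linear independence is the
  triviality of the kernel.
\<close>

lemma lin_combination_bij:
  assumes V: "nonassoc_algebra class_ring V" and e: "natural_basis n V e"
  shows "bij_betw (lin_combination n V e) (carrier_vec n) (carrier V)"
proof -
  \<comment> \<open>The identity matrix only serves to name a module on the column vectors.\<close>
  let ?\<phi> = "lin_combination n V e" and ?E = "evo n (1\<^sub>m n)"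
  have E: "nonassoc_algebra class_ring ?E" by (rule evo_nonassoc_algebra) simp
  interpret V: nonassoc_algebra class_ring V by (rule V)
  interpret E: nonassoc_algebra class_ring ?E by (rule E)
  interpret \<phi>: linear_map class_ring ?E V ?\<phi>
    by unfold_locales (rule lin_combination_module_hom[OF V e])
  note ec = natural_basisD(1)[OF V e] and inj = natural_basisD(4)[OF V e]
  have "\<phi>.im = carrier V"
  proof (rule submodule_containing_basis[OF V e \<phi>.im_is_submodule])
    fix i assume "i < n"
    then show "e i \<in> \<phi>.im"
      using lin_combination_unit_vec[OF V e] by (auto simp: \<phi>.im_def intro!: image_eqI[of _ _ "unit_vec n i"])
  qed
  moreover have "x = 0\<^sub>v n" if x: "x \<in> carrier_vec n" and 0: "?\<phi> x = \<zero>\<^bsub>V\<^esub>" for x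
  proof (rule eq_vecI)
    fix i assume "i < dim_vec (0\<^sub>v n :: 'a vec)"
    then have i: "i < n" by simp
    \<comment> \<open>Linear independence is stated for coefficients indexed by the basis vectors themselves.\<close>
    define a where "a v = x $ inv_into {..<n} e v" for v
    have "V.lincomb a (e ` {..<n}) = (\<Oplus>\<^bsub>V\<^esub>i\<in>{..<n}. a (e i) \<odot>\<^bsub>V\<^esub> e i)"
      unfolding V.lincomb_def using inj ec by (intro V.finsum_reindex) auto
    also have "\<dots> = ?\<phi> x"
      unfolding lin_combination_def using ec inj by (intro V.finsum_cong') (auto simp: a_def)
    finally have "V.lincomb a (e ` {..<n}) = \<zero>\<^bsub>V\<^esub>" using 0 by simp
    then have "a (e i) = 0"
      using V.lin_dep_crit[of "e ` {..<n}" "e ` {..<n}" a "e i"] natural_basisD(3)[OF V e] i by auto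
    then show "x $ i = 0\<^sub>v n $ i" using i inj by (simp add: a_def)
  qed (use x in simp)
  then have "inj_on ?\<phi> (carrier ?E)"
    using \<phi>.f0_is_0 by (intro \<phi>.Ke0_imp_inj) (auto simp: \<phi>.ker_def)
  ultimately show ?thesis by (simp add: bij_betw_def \<phi>.im_def)
qed

lemma structure_matrix_exists:
  assumes V: "nonassoc_algebra class_ring V" and e: "natural_basis n V e"
  shows "\<exists>A. structure_matrix n V e A"
proof -
  interpret V: nonassoc_algebra class_ring V by (rule V)
  note ec = natural_basisD(1)[OF V e]
  have "\<exists>c. e j \<otimes>\<^bsub>V\<^esub> e j = lin_combination n V e c" if "j < n" for j
    using lin_combination_bij[OF V e] V.mult_closed[OF ec[OF that] ec[OF that]]
    unfolding bij_betw_def by (metis imageE)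
  then obtain c where c: "\<And>j. j < n \<Longrightarrow> e j \<otimes>\<^bsub>V\<^esub> e j = lin_combination n V e (c j)"
    by metis
  have "structure_matrix n V e (mat n n (\<lambda>(i, j). c j $ i))"
    unfolding structure_matrix_def
  proof (intro conjI allI impI)
    fix j assume j: "j < n"
    show "e j \<otimes>\<^bsub>V\<^esub> e j = (\<Oplus>\<^bsub>V\<^esub>i\<in>{..<n}. mat n n (\<lambda>(i, j). c j $ i) $$ (i, j) \<odot>\<^bsub>V\<^esub> e i)"
      unfolding c[OF j] lin_combination_def using j ec by (intro V.finsum_cong') auto
  qed simp
  then show ?thesis ..
qed

lemma evo_mult_unit_vec:
  fixes A :: "'a :: field mat"
  assumes A: "A \<in> carrier_mat n n" and i: "i < n" and j: "j < n"
  shows "unit_vec n i \<otimes>\<^bsub>evo n A\<^esub> unit_vec n j = (if i = j then A *\<^sub>v unit_vec n j else 0\<^sub>v n)"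
  using natural_basisD(5)[OF evo_nonassoc_algebra[OF A] evo_structure_matrix(1)[OF A] i j]
    hadamard_unit_vec(1)[OF j, where 'a = 'a] by auto

text \<open>
  The coordinate map sends \<open>e\<^sub>j e\<^sub>j\<close>, which is column \<open>j\<close> of \<open>A\<close>, to the combination that defines
  the structure matrix, and products of distinct basis vectors vanish on both sides.
\<close>

lemma evo_isomorphic:
  assumes V: "nonassoc_algebra class_ring V" and e: "natural_basis n V e"
    and A: "structure_matrix n V e A"
  shows "algebra_isomorphic class_ring (evo n A) V"
proof -
  let ?\<phi> = "lin_combination n V e"
  have Ac: "A \<in> carrier_mat n n" using A by (simp add: structure_matrix_def)
  have E: "nonassoc_algebra class_ring (evo n A)" by (rule evo_nonassoc_algebra[OF Ac])
  interpret V: nonassoc_algebra class_ring V by (rule V)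
  interpret E: nonassoc_algebra class_ring "evo n A" by (rule E)
  interpret \<phi>: mod_hom class_ring "evo n A" V ?\<phi>
    by unfold_locales (rule lin_combination_module_hom[OF V e])
  note ec = natural_basisD(1)[OF V e]
  have "?\<phi> \<in> hom (evo n A) V"
  proof (rule hom_if_multiplicative_on_basis[OF E evo_structure_matrix(1)[OF Ac] V \<phi>.f_hom])
    fix i j assume i: "i < n" and j: "j < n"
    have diag: "?\<phi> (A *\<^sub>v unit_vec n j) = e j \<otimes>\<^bsub>V\<^esub> e j"
    proof -
      have "?\<phi> (A *\<^sub>v unit_vec n j) = (\<Oplus>\<^bsub>V\<^esub>i\<in>{..<n}. A $$ (i, j) \<odot>\<^bsub>V\<^esub> e i)"
        unfolding lin_combination_def mult_mat_vec_unit_vec[OF Ac j]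
        using Ac j ec by (intro V.finsum_cong') auto
      then show ?thesis using A j by (simp add: structure_matrix_def)
    qed
    show "?\<phi> (unit_vec n i \<otimes>\<^bsub>evo n A\<^esub> unit_vec n j) = ?\<phi> (unit_vec n i) \<otimes>\<^bsub>V\<^esub> ?\<phi> (unit_vec n j)"
    proof (cases "i = j")
      case True
      then show ?thesis
        unfolding evo_mult_unit_vec[OF Ac i j] lin_combination_unit_vec[OF V e i]
          lin_combination_unit_vec[OF V e j]
        by (simp add: diag)
    next
      case False
      then show ?thesis
        unfolding evo_mult_unit_vec[OF Ac i j] lin_combination_unit_vec[OF V e i]
          lin_combination_unit_vec[OF V e j]
        using natural_basisD(5)[OF V e i j] \<phi>.f0_is_0 by simp
    qed
  qed
  then show ?thesis
    using lin_combination_bij[OF V e] \<phi>.f_hom by (auto simp: algebra_isomorphic_def iso_def)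
qed

section \<open>Idempotent algebras\<close>

text \<open>
  Under an isomorphism \<open>f\<close> from \<open>V\<close> onto \<open>W\<close>, the preimage of \<open>W\<^sup>2\<close> is a submodule that contains all
  products of \<open>V\<close>, hence contains \<open>V\<^sup>2 = V\<close>.
\<close>

lemma idempotent_algebra_isomorphic:
  assumes V: "nonassoc_algebra class_ring V" and W: "nonassoc_algebra class_ring W"
    and iso: "algebra_isomorphic class_ring V W" and idem: "idempotent_algebra V"
  shows "idempotent_algebra W"
proof -
  interpret V: nonassoc_algebra class_ring V by (rule V)
  interpret W: nonassoc_algebra class_ring W by (rule W)
  from iso obtain f where fh: "f \<in> LinearCombinations.module_hom class_ring V W" and fi: "f \<in> iso V W"
    by (auto simp: algebra_isomorphic_def)
  interpret f: mod_hom class_ring V W f by unfold_locales (rule fh)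
  have hom: "f \<in> hom V W" and bij: "bij_betw f (carrier V) (carrier W)"
    using fi by (auto simp: iso_def)
  let ?P = "{x \<otimes>\<^bsub>W\<^esub> y | x y. x \<in> carrier W \<and> y \<in> carrier W}"
  have Pc: "?P \<subseteq> carrier W" using W.mult_closed by auto
  have sub: "submodule class_ring (W.span ?P) W" by (rule W.span_is_submodule[OF Pc])
  interpret S: submodule class_ring "W.span ?P" W by (rule sub)
  have "submodule class_ring {x \<in> carrier V. f x \<in> W.span ?P} V"
    by (rule submodule.intro) (auto intro: V.module_axioms)
  then have "V.span {x \<otimes>\<^bsub>V\<^esub> y | x y. x \<in> carrier V \<and> y \<in> carrier V} \<subseteq>
      {x \<in> carrier V. f x \<in> W.span ?P}"
  proof (rule V.span_is_subset[rotated], safe)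
    fix x y assume xy: "x \<in> carrier V" "y \<in> carrier V"
    then show "x \<otimes>\<^bsub>V\<^esub> y \<in> carrier V" by (rule V.mult_closed)
    have "f x \<otimes>\<^bsub>W\<^esub> f y \<in> ?P" using xy by auto
    then show "f (x \<otimes>\<^bsub>V\<^esub> y) \<in> W.span ?P"
      using W.in_own_span[OF Pc] hom_mult[OF hom xy] by auto
  qed
  then have "carrier V \<subseteq> {x \<in> carrier V. f x \<in> W.span ?P}"
    using idem by (simp add: idempotent_algebra_def)
  then have "f ` carrier V \<subseteq> W.span ?P" by blast
  then have "carrier W \<subseteq> W.span ?P" using bij by (simp only: bij_betw_def)
  with S.subset show ?thesis unfolding idempotent_algebra_def by (rule subset_antisym)
qed

text \<open>
  Since \<open>z = z \<circ> u\<close> for the all-ones vector \<open>u\<close>, the products of \<open>\<E>(A)\<close> are all the vectors \<open>A z\<close>.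
  They already form a subspace, so \<open>\<E>(A)\<^sup>2\<close> is the column space of \<open>A\<close>.
\<close>

lemma evo_idempotent_iff:
  fixes A :: "'a :: field mat"
  assumes A: "A \<in> carrier_mat n n"
  shows "idempotent_algebra (evo n A) \<longleftrightarrow> A \<in> carrier (GL n)"
proof -
  interpret E: nonassoc_algebra class_ring "evo n A" by (rule evo_nonassoc_algebra[OF A])
  let ?P = "{x \<otimes>\<^bsub>evo n A\<^esub> y | x y. x \<in> carrier (evo n A) \<and> y \<in> carrier (evo n A)}"
  let ?I = "(\<lambda>z. A *\<^sub>v z) ` carrier_vec n"
  have P: "?P = ?I"
  proof (intro equalityI subsetI)
    fix p assume "p \<in> ?I"
    then obtain z where z: "z \<in> carrier_vec n" and p: "p = A *\<^sub>v z" by auto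
    have "hadamard n z (vec n (\<lambda>_. 1)) = z" using z by auto
    then have "p = z \<otimes>\<^bsub>evo n A\<^esub> vec n (\<lambda>_. 1)" by (simp add: p)
    then show "p \<in> ?P" using z by force
  qed auto
  have "submodule class_ring ?I (evo n A)"
  proof (rule submodule.intro)
    show "\<zero>\<^bsub>evo n A\<^esub> \<in> ?I" using A by (auto intro!: image_eqI[of _ _ "0\<^sub>v n"])
    show "v \<oplus>\<^bsub>evo n A\<^esub> w \<in> ?I" if "v \<in> ?I" "w \<in> ?I" for v w
      using that A by (auto simp flip: mult_add_distrib_mat_vec)
    show "c \<odot>\<^bsub>evo n A\<^esub> v \<in> ?I" if "v \<in> ?I" for c v
      using that A by (auto simp flip: mult_mat_vec)
  qed (use A in \<open>auto intro: E.module_axioms\<close>)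
  then have "E.span ?I \<subseteq> ?I" by (rule E.span_is_subset[OF subset_refl])
  moreover have "?I \<subseteq> carrier (evo n A)" using A by auto
  ultimately have "E.span ?I = ?I" using E.in_own_span by blast
  then have "idempotent_algebra (evo n A) \<longleftrightarrow> ?I = carrier_vec n"
    unfolding idempotent_algebra_def P by simp
  also have "\<dots> \<longleftrightarrow> (\<forall>y \<in> carrier_vec n. \<exists>x \<in> carrier_vec n. A *\<^sub>v x = y)"
    using \<open>?I \<subseteq> carrier (evo n A)\<close> by (auto simp: set_eq_iff image_iff eq_commute)
  finally show ?thesis using A by (simp add: GL_iff_surj)
qed

lemma evo_in_idempotent_evolution_algebras:
  assumes "A \<in> carrier (GL n)"
  shows "evo n A \<in> idempotent_evolution_algebras n"
proof -
  note A = GL_carrier_mat[OF assms]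
  show ?thesis
    unfolding idempotent_evolution_algebras_def evolution_algebra_def
    using evo_structure_matrix(1)[OF A] evo_nonassoc_algebra[OF A] evo_idempotent_iff[OF A] assms
    by blast
qed

lemma structure_matrix_in_GL:
  assumes V: "V \<in> idempotent_evolution_algebras n" and e: "natural_basis n V e"
    and A: "structure_matrix n V e A"
  shows "A \<in> carrier (GL n)"
proof -
  have Va: "nonassoc_algebra class_ring V" and idem: "idempotent_algebra V"
    using V by (auto simp: idempotent_evolution_algebras_def evolution_algebra_def)
  have Ac: "A \<in> carrier_mat n n" using A by (simp add: structure_matrix_def)
  note E = evo_nonassoc_algebra[OF Ac]
  have "algebra_isomorphic class_ring V (evo n A)"
    by (rule algebra_isomorphic_sym[OF E evo_isomorphic[OF Va e A]])
  from idempotent_algebra_isomorphic[OF Va E this idem] show ?thesis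
    using evo_idempotent_iff[OF Ac] by simp
qed

section \<open>Isomorphisms and orbits\<close>

lemma mult_mat_vec_module_hom:
  fixes g :: "'a :: field mat"
  assumes g: "g \<in> carrier_mat n n"
  shows "(\<lambda>x. g *\<^sub>v x) \<in> LinearCombinations.module_hom class_ring (evo n B) (evo n A)"
  using g by (auto simp: LinearCombinations.module_hom_def mult_add_distrib_mat_vec mult_mat_vec)

lemma evo_module_hom_mat:
  fixes A B :: "'a :: field mat"
  assumes A: "A \<in> carrier_mat n n" and B: "B \<in> carrier_mat n n"
    and f: "f \<in> LinearCombinations.module_hom class_ring (evo n B) (evo n A)"
  shows "\<exists>g \<in> carrier_mat n n. \<forall>x \<in> carrier_vec n. f x = g *\<^sub>v x"
proof
  let ?g = "mat n n (\<lambda>(i, j). f (unit_vec n j) $ i)"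
  show g: "?g \<in> carrier_mat n n" by simp
  show "\<forall>x \<in> carrier_vec n. f x = ?g *\<^sub>v x"
  proof
    fix x :: "'a vec" assume "x \<in> carrier_vec n"
    then have x: "x \<in> carrier (evo n B)" by simp
    show "f x = ?g *\<^sub>v x"
    proof (rule module_hom_eq_on_basis[OF evo_nonassoc_algebra[OF B] evo_structure_matrix(1)[OF B]
          evo_nonassoc_algebra[OF A] f mult_mat_vec_module_hom[OF g] _ x])
      fix j assume j: "j < n"
      have "f (unit_vec n j) \<in> carrier_vec n" using LinearCombinations.module_hom_closed[OF f] by auto
      then show "f (unit_vec n j) = ?g *\<^sub>v unit_vec n j"
        unfolding mult_mat_vec_unit_vec[OF g j] using j by auto
    qed
  qed
qed

text \<open>
  The products of distinct basis vectors give the disjointness of the columns of \<open>g\<close>, where the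
  injectivity of \<open>A\<close> enters; the squares of the basis vectors give the matrix equation.
\<close>

lemma evo_hom_iff:
  fixes A B :: "'a :: field mat"
  assumes A: "A \<in> carrier (GL n)" and B: "B \<in> carrier_mat n n" and g: "g \<in> carrier_mat n n"
  shows "(\<lambda>x. g *\<^sub>v x) \<in> hom (evo n B) (evo n A) \<longleftrightarrow>
    disjoint_columns n g \<and> g * B = A * sq_mat g"
proof -
  note Ac = GL_carrier_mat[OF A]
  note EA = evo_nonassoc_algebra[OF Ac] and EB = evo_nonassoc_algebra[OF B]
  let ?u = "unit_vec n :: nat \<Rightarrow> 'a vec"
  let ?H = "\<lambda>i j. hadamard n (g *\<^sub>v ?u i) (g *\<^sub>v ?u j)"
  have zero: "M *\<^sub>v 0\<^sub>v n = 0\<^sub>v n" if "M \<in> carrier_mat n n" for M :: "'a mat"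
    using that by (auto intro!: eq_vecI)
  have "(\<lambda>x. g *\<^sub>v x) \<in> hom (evo n B) (evo n A) \<longleftrightarrow>
      (\<forall>i<n. \<forall>j<n. g *\<^sub>v (?u i \<otimes>\<^bsub>evo n B\<^esub> ?u j) = A *\<^sub>v ?H i j)"
  proof
    assume "(\<lambda>x. g *\<^sub>v x) \<in> hom (evo n B) (evo n A)"
    then show "\<forall>i<n. \<forall>j<n. g *\<^sub>v (?u i \<otimes>\<^bsub>evo n B\<^esub> ?u j) = A *\<^sub>v ?H i j"
      by (auto simp: hom_def)
  next
    assume *: "\<forall>i<n. \<forall>j<n. g *\<^sub>v (?u i \<otimes>\<^bsub>evo n B\<^esub> ?u j) = A *\<^sub>v ?H i j"
    show "(\<lambda>x. g *\<^sub>v x) \<in> hom (evo n B) (evo n A)"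
      by (rule hom_if_multiplicative_on_basis[OF EB evo_structure_matrix(1)[OF B] EA
            mult_mat_vec_module_hom[OF g]]) (use * in simp)
  qed
  also have "\<dots> \<longleftrightarrow> (\<forall>i<n. \<forall>j<n. i \<noteq> j \<longrightarrow> ?H i j = 0\<^sub>v n) \<and>
      (\<forall>j<n. g *\<^sub>v (B *\<^sub>v ?u j) = A *\<^sub>v (sq_mat g *\<^sub>v ?u j))"
  proof -
    have off: "g *\<^sub>v (?u i \<otimes>\<^bsub>evo n B\<^esub> ?u j) = A *\<^sub>v ?H i j \<longleftrightarrow> ?H i j = 0\<^sub>v n"
      if "i < n" "j < n" "i \<noteq> j" for i j
      unfolding evo_mult_unit_vec[OF B that(1,2)]
      using that(3) zero[OF g] zero[OF Ac] GL_mult_vec_eq_zero[OF A, of "?H i j"] by auto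
    have diag: "g *\<^sub>v (?u j \<otimes>\<^bsub>evo n B\<^esub> ?u j) = A *\<^sub>v ?H j j \<longleftrightarrow>
        g *\<^sub>v (B *\<^sub>v ?u j) = A *\<^sub>v (sq_mat g *\<^sub>v ?u j)" if "j < n" for j
      unfolding evo_mult_unit_vec[OF B that that] sq_mat_mult_unit_vec[OF g that] by simp
    let ?P = "\<lambda>i j. g *\<^sub>v (?u i \<otimes>\<^bsub>evo n B\<^esub> ?u j) = A *\<^sub>v ?H i j"
    show ?thesis
    proof (intro iffI conjI allI impI)
      fix i j assume P: "\<forall>i<n. \<forall>j<n. ?P i j" and ij: "i < n" "j < n" "i \<noteq> j"
      from P ij have "?P i j" by blast
      with off[OF ij] show "?H i j = 0\<^sub>v n" by (rule iffD1)
    next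
      fix j assume P: "\<forall>i<n. \<forall>j<n. ?P i j" and j: "j < n"
      from P j have "?P j j" by blast
      with diag[OF j] show "g *\<^sub>v (B *\<^sub>v ?u j) = A *\<^sub>v (sq_mat g *\<^sub>v ?u j)" by (rule iffD1)
    next
      fix i j assume R: "(\<forall>i<n. \<forall>j<n. i \<noteq> j \<longrightarrow> ?H i j = 0\<^sub>v n) \<and>
          (\<forall>j<n. g *\<^sub>v (B *\<^sub>v ?u j) = A *\<^sub>v (sq_mat g *\<^sub>v ?u j))" and ij: "i < n" "j < n"
      show "?P i j"
      proof (cases "i = j")
        case True
        from R ij have "g *\<^sub>v (B *\<^sub>v ?u j) = A *\<^sub>v (sq_mat g *\<^sub>v ?u j)" by blast
        with diag[OF ij(2)] have "?P j j" by (rule iffD2)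
        with True show ?thesis by (simp only:)
      next
        case False
        from R ij False have "?H i j = 0\<^sub>v n" by blast
        with off[OF ij False] show ?thesis by (rule iffD2)
      qed
    qed
  qed
  also have "(\<forall>j<n. g *\<^sub>v (B *\<^sub>v ?u j) = A *\<^sub>v (sq_mat g *\<^sub>v ?u j)) \<longleftrightarrow>
      (\<forall>j<n. (g * B) *\<^sub>v ?u j = (A * sq_mat g) *\<^sub>v ?u j)"
    using assoc_mult_mat_vec[OF g B] assoc_mult_mat_vec[OF Ac, of "sq_mat g" n] g by simp
  also have "\<dots> \<longleftrightarrow> g * B = A * sq_mat g"
  proof
    assume "\<forall>j<n. (g * B) *\<^sub>v ?u j = (A * sq_mat g) *\<^sub>v ?u j"
    then show "g * B = A * sq_mat g"
      by (intro mat_eqI_unit_vec[of _ n n] mult_carrier_mat[OF g B] mult_carrier_mat[OF Ac]) (use g in auto)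
  qed simp
  finally show ?thesis by (simp add: disjoint_columns_iff_hadamard[OF g])
qed

lemma GL_iff_bij:
  fixes g :: "'a :: field mat"
  assumes g: "g \<in> carrier_mat n n"
  shows "g \<in> carrier (GL n) \<longleftrightarrow> bij_betw (\<lambda>x. g *\<^sub>v x) (carrier_vec n) (carrier_vec n)"
proof
  assume G: "g \<in> carrier (GL n)"
  show "bij_betw (\<lambda>x. g *\<^sub>v x) (carrier_vec n) (carrier_vec n)"
    using GL_mult_vec_cancel[OF G] g GL_inv(2)[OF G]
    by (intro bij_betw_byWitness[where f' = "\<lambda>x. inv\<^bsub>GL n\<^esub> g *\<^sub>v x"]) auto
next
  assume "bij_betw (\<lambda>x. g *\<^sub>v x) (carrier_vec n) (carrier_vec n)"
  then show "g \<in> carrier (GL n)"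
    using g unfolding GL_iff_surj bij_betw_def by (metis imageE)
qed

lemma evo_isomorphic_iff:
  fixes A B :: "'a :: field mat"
  assumes A: "A \<in> carrier (GL n)" and B: "B \<in> carrier_mat n n"
  shows "algebra_isomorphic class_ring (evo n B) (evo n A) \<longleftrightarrow>
    (\<exists>g \<in> carrier (monomial_group n). B = evo_act n g A)"
proof -
  note Ac = GL_carrier_mat[OF A]
  have "algebra_isomorphic class_ring (evo n B) (evo n A) \<longleftrightarrow>
      (\<exists>g \<in> carrier_mat n n. (\<lambda>x. g *\<^sub>v x) \<in> iso (evo n B) (evo n A))"
  proof
    assume "algebra_isomorphic class_ring (evo n B) (evo n A)"
    then obtain f where f: "f \<in> LinearCombinations.module_hom class_ring (evo n B) (evo n A)"
        "f \<in> iso (evo n B) (evo n A)"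
      by (auto simp: algebra_isomorphic_def)
    obtain g where g: "g \<in> carrier_mat n n" "\<And>x. x \<in> carrier_vec n \<Longrightarrow> f x = g *\<^sub>v x"
      using evo_module_hom_mat[OF Ac B f(1)] by auto
    interpret E: nonassoc_algebra class_ring "evo n B" by (rule evo_nonassoc_algebra[OF B])
    have fg: "f x = g *\<^sub>v x" if "x \<in> carrier (evo n B)" for x
      using g(2) that by simp
    have hom: "f \<in> hom (evo n B) (evo n A)" and bij: "bij_betw f (carrier (evo n B)) (carrier (evo n A))"
      using f(2) by (auto simp: iso_def)
    have "(\<lambda>x. g *\<^sub>v x) \<in> hom (evo n B) (evo n A)"
    proof (rule homI)
      fix x y assume xy: "x \<in> carrier (evo n B)" "y \<in> carrier (evo n B)"
      show "g *\<^sub>v (x \<otimes>\<^bsub>evo n B\<^esub> y) = (g *\<^sub>v x) \<otimes>\<^bsub>evo n A\<^esub> (g *\<^sub>v y)"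
        using hom_mult[OF hom xy] unfolding fg[OF xy(1)] fg[OF xy(2)] fg[OF E.mult_closed[OF xy]] .
    qed (use g(1) in simp)
    moreover have "bij_betw (\<lambda>x. g *\<^sub>v x) (carrier (evo n B)) (carrier (evo n A))"
      using bij by (simp only: bij_betw_cong[OF fg])
    ultimately have "(\<lambda>x. g *\<^sub>v x) \<in> iso (evo n B) (evo n A)" by (simp add: iso_def)
    with g show "\<exists>g \<in> carrier_mat n n. (\<lambda>x. g *\<^sub>v x) \<in> iso (evo n B) (evo n A)" by blast
  next
    assume "\<exists>g \<in> carrier_mat n n. (\<lambda>x. g *\<^sub>v x) \<in> iso (evo n B) (evo n A)"
    then show "algebra_isomorphic class_ring (evo n B) (evo n A)"
      unfolding algebra_isomorphic_def using mult_mat_vec_module_hom by blast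
  qed
  also have "\<dots> \<longleftrightarrow> (\<exists>g \<in> carrier_mat n n. g \<in> carrier (GL n) \<and> disjoint_columns n g \<and>
      g * B = A * sq_mat g)"
    using evo_hom_iff[OF A B] GL_iff_bij by (intro bex_cong refl) (auto simp: iso_def)
  also have "\<dots> \<longleftrightarrow> (\<exists>g \<in> carrier (monomial_group n). g * B = A * sq_mat g)"
    unfolding Bex_def monomial_group_iff using GL_carrier_mat by blast
  also have "\<dots> \<longleftrightarrow> (\<exists>g \<in> carrier (monomial_group n). B = evo_act n g A)"
  proof (intro bex_cong refl)
    fix g :: "'a mat" assume "g \<in> carrier (monomial_group n)"
    then have g: "g \<in> carrier (GL n)" by (simp add: monomial_group_iff)
    have "evo_act n g A = inv\<^bsub>GL n\<^esub> g * (A * sq_mat g)"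
      unfolding evo_act_def
      using GL_inv(2)[OF g] Ac GL_carrier_mat[OF g] by (intro assoc_mult_mat) auto
    then show "g * B = A * sq_mat g \<longleftrightarrow> B = evo_act n g A"
      using GL_mult_left_eq_iff[OF g B, of "A * sq_mat g"] Ac GL_carrier_mat[OF g] by auto
  qed
  finally show ?thesis .
qed

text \<open>
  Orbits are described by isomorphism alone, so that equality of orbits becomes a statement
  about an equivalence relation of algebras.
\<close>

lemma orbit_eq_isomorphic_evo:
  fixes A :: "'a :: field mat"
  assumes A: "A \<in> carrier (GL n)"
  shows "orbit (monomial_group n) (evo_act n) A =
    {B \<in> carrier (GL n). algebra_isomorphic class_ring (evo n A) (evo n B)}"
proof -
  have sym: "algebra_isomorphic class_ring (evo n A) (evo n B) \<longleftrightarrow>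
      algebra_isomorphic class_ring (evo n B) (evo n A)" if "B \<in> carrier (GL n)" for B
    using A that by (blast intro: algebra_isomorphic_sym evo_nonassoc_algebra GL_carrier_mat)
  have "evo_act n g A \<in> carrier (GL n)" if "g \<in> carrier (monomial_group n)" for g
    using evo_act_right_action[where 'a = 'a and n = n] A that unfolding right_action_def by blast
  then have "orbit (monomial_group n) (evo_act n) A =
      {B \<in> carrier (GL n). \<exists>g \<in> carrier (monomial_group n). B = evo_act n g A}"
    by (auto simp: orbit_def)
  also have "\<dots> = {B \<in> carrier (GL n). algebra_isomorphic class_ring (evo n A) (evo n B)}"
    by (intro Collect_cong conj_cong refl) (simp only: sym evo_isomorphic_iff[OF A GL_carrier_mat])
  finally show ?thesis .
qed

lemma isomorphism_rel_equiv:
  "equiv (idempotent_evolution_algebras n :: ('a :: field, 'v) module set) (isomorphism_rel n)"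
proof (rule equivI)
  show "isomorphism_rel n \<subseteq> idempotent_evolution_algebras n \<times>
      (idempotent_evolution_algebras n :: ('a, 'v) module set)"
    by (auto simp: isomorphism_rel_def)
  show "refl_on (idempotent_evolution_algebras n :: ('a, 'v) module set) (isomorphism_rel n)"
    by (auto simp: refl_on_def isomorphism_rel_def algebra_isomorphic_refl)
  show "sym (isomorphism_rel n :: (('a, 'v) module \<times> _) set)"
    by (auto simp: sym_def isomorphism_rel_def idempotent_evolution_algebras_def
        evolution_algebra_def intro: algebra_isomorphic_sym)
  show "trans (isomorphism_rel n :: (('a, 'v) module \<times> _) set)"
    by (auto simp: trans_def isomorphism_rel_def intro: algebra_isomorphic_trans)
qed

text \<open>
  Any natural basis of \<open>V\<close> may be used: the orbit of its structure matrix depends only on \<open>V\<close>.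
\<close>

lemma isomorphic_evo_eq_orbit:
  fixes V :: "('a :: field, 'v) module"
  assumes V: "V \<in> idempotent_evolution_algebras n" and e: "natural_basis n V e"
    and A: "structure_matrix n V e A"
  shows "{B \<in> carrier (GL n). algebra_isomorphic class_ring V (evo n B)} =
    orbit (monomial_group n) (evo_act n) A"
proof -
  have Va: "nonassoc_algebra class_ring V"
    using V by (simp add: idempotent_evolution_algebras_def evolution_algebra_def)
  have GL: "A \<in> carrier (GL n)" by (rule structure_matrix_in_GL[OF V e A])
  have AV: "algebra_isomorphic class_ring (evo n A) V" by (rule evo_isomorphic[OF Va e A])
  have VA: "algebra_isomorphic class_ring V (evo n A)"
    by (rule algebra_isomorphic_sym[OF evo_nonassoc_algebra[OF GL_carrier_mat[OF GL]] AV])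
  show ?thesis
    unfolding orbit_eq_isomorphic_evo[OF GL]
    using algebra_isomorphic_trans[OF AV] algebra_isomorphic_trans[OF VA] by blast
qed

text \<open>
  The orbit of \<open>A\<close> and the isomorphism class of \<open>\<E>(A)\<close> determine each other, which makes the map
  well defined and injective; it is surjective because every idempotent evolution algebra has a
  structure matrix, which is nonsingular.
\<close>

lemma orbits_bij_isomorphism_classes:
  fixes n :: nat
  shows "\<exists>\<Phi>. bij_betw \<Phi>
        (orbits (monomial_group n) (carrier (GL n)) (evo_act n) :: 'a :: field mat set set)
        ((idempotent_evolution_algebras n :: ('a, 'a vec) module set) // isomorphism_rel n) \<and>
      (\<forall>A \<in> carrier (GL n).
        \<Phi> (orbit (monomial_group n) (evo_act n) A) = isomorphism_rel n `` {evo n A})"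
proof -
  let ?orb = "\<lambda>A :: 'a mat. orbit (monomial_group n) (evo_act n) A"
  let ?cls = "\<lambda>A :: 'a mat. isomorphism_rel n `` {evo n A}"
  have cls_eq: "?cls A = ?cls B \<longleftrightarrow> algebra_isomorphic class_ring (evo n A) (evo n B)"
    if "A \<in> carrier (GL n)" "B \<in> carrier (GL n)" for A B
    using that eq_equiv_class_iff[OF isomorphism_rel_equiv, of "evo n A" n "evo n B"]
    by (simp add: evo_in_idempotent_evolution_algebras isomorphism_rel_def)
  have orb_eq: "?orb A = ?orb B \<longleftrightarrow> ?cls A = ?cls B"
    if A: "A \<in> carrier (GL n)" and B: "B \<in> carrier (GL n)" for A B
  proof
    assume eq: "?orb A = ?orb B"
    have "B \<in> ?orb B" using B by (simp add: orbit_eq_isomorphic_evo algebra_isomorphic_refl)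
    then have "B \<in> ?orb A" using eq by simp
    then show "?cls A = ?cls B" using A B by (simp add: orbit_eq_isomorphic_evo cls_eq)
  next
    assume "?cls A = ?cls B"
    then show "?orb A = ?orb B"
      using cls_eq[OF A] cls_eq[OF B] unfolding orbit_eq_isomorphic_evo[OF A] orbit_eq_isomorphic_evo[OF B]
      by auto
  qed
  define \<Phi> where "\<Phi> X = ?cls (SOME A. A \<in> carrier (GL n) \<and> ?orb A = X)" for X
  have \<Phi>: "\<Phi> (?orb A) = ?cls A" if A: "A \<in> carrier (GL n)" for A
  proof -
    have "(SOME B. B \<in> carrier (GL n) \<and> ?orb B = ?orb A) \<in> carrier (GL n) \<and>
        ?orb (SOME B. B \<in> carrier (GL n) \<and> ?orb B = ?orb A) = ?orb A"
      by (rule someI[of _ A]) (use A in simp)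
    then show ?thesis unfolding \<Phi>_def using orb_eq[OF _ A] by blast
  qed
  have "bij_betw \<Phi> (orbits (monomial_group n) (carrier (GL n)) (evo_act n))
      ((idempotent_evolution_algebras n :: ('a, 'a vec) module set) // isomorphism_rel n)"
    unfolding bij_betw_def
  proof
    show "inj_on \<Phi> (orbits (monomial_group n) (carrier (GL n)) (evo_act n))"
    proof (rule inj_onI)
      fix X Y
      assume "X \<in> orbits (monomial_group n) (carrier (GL n)) (evo_act n)"
        and "Y \<in> orbits (monomial_group n) (carrier (GL n)) (evo_act n)" and eq: "\<Phi> X = \<Phi> Y"
      then obtain A B where "A \<in> carrier (GL n)" "X = ?orb A" "B \<in> carrier (GL n)" "Y = ?orb B"
        by (auto simp: orbits_def)
      with eq show "X = Y" using \<Phi> orb_eq by metis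
    qed
    have "X \<in> \<Phi> ` orbits (monomial_group n) (carrier (GL n)) (evo_act n)"
      if X: "X \<in> (idempotent_evolution_algebras n :: ('a, 'a vec) module set) // isomorphism_rel n" for X
    proof -
      from X obtain V :: "('a, 'a vec) module" where V: "V \<in> idempotent_evolution_algebras n"
          and XV: "X = isomorphism_rel n `` {V}"
        by (rule quotientE)
      then obtain e where Va: "nonassoc_algebra class_ring V" and e: "natural_basis n V e"
        by (auto simp: idempotent_evolution_algebras_def evolution_algebra_def)
      obtain A where A: "structure_matrix n V e A" using structure_matrix_exists[OF Va e] ..
      have GL: "A \<in> carrier (GL n)" by (rule structure_matrix_in_GL[OF V e A])
      have "(evo n A, V) \<in> isomorphism_rel n"
        using evo_isomorphic[OF Va e A] evo_in_idempotent_evolution_algebras[OF GL] V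
        by (simp add: isomorphism_rel_def)
      then have "X = \<Phi> (?orb A)"
        using \<Phi>[OF GL] XV equiv_class_eq[OF isomorphism_rel_equiv] by metis
      then show ?thesis using GL by (auto simp: orbits_def)
    qed
    moreover have "\<Phi> ` orbits (monomial_group n) (carrier (GL n)) (evo_act n) \<subseteq>
        (idempotent_evolution_algebras n :: ('a, 'a vec) module set) // isomorphism_rel n"
    proof
      fix X assume "X \<in> \<Phi> ` orbits (monomial_group n) (carrier (GL n)) (evo_act n)"
      then obtain A where A: "A \<in> carrier (GL n)" and X: "X = ?cls A" by (auto simp: orbits_def \<Phi>)
      show "X \<in> (idempotent_evolution_algebras n :: ('a, 'a vec) module set) // isomorphism_rel n"
        unfolding X by (rule quotientI[OF evo_in_idempotent_evolution_algebras[OF A]])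
    qed
    ultimately show "\<Phi> ` orbits (monomial_group n) (carrier (GL n)) (evo_act n) =
        (idempotent_evolution_algebras n :: ('a, 'a vec) module set) // isomorphism_rel n"
      by blast
  qed
  with \<Phi> show ?thesis by blast
qed

theorem corollary1p1:
  fixes n :: nat
  assumes "n \<ge> 1"
  shows "subgroup (carrier (monomial_group n)) (GL n :: 'a :: field mat monoid) \<and>
    right_action (monomial_group n) (carrier (GL n)) (evo_act n :: 'a mat \<Rightarrow> 'a mat \<Rightarrow> 'a mat) \<and>
    (\<forall>s \<in> perm_mats n. \<forall>t \<in> torus n. \<forall>A \<in> carrier (GL n :: 'a mat monoid).
      evo_act n (s * t) A = inv\<^bsub>GL n\<^esub> t * inv\<^bsub>GL n\<^esub> s * A * s * (t * t)) \<and>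
    (\<exists>\<Phi>. bij_betw \<Phi>
        (orbits (monomial_group n) (carrier (GL n)) (evo_act n) :: 'a mat set set)
        ((idempotent_evolution_algebras n :: ('a, 'a vec) module set) // isomorphism_rel n) \<and>
      (\<forall>A \<in> carrier (GL n).
        \<Phi> (orbit (monomial_group n) (evo_act n) A) = isomorphism_rel n `` {evo n A})) \<and>
    (\<forall>(V :: ('a, 'v) module) e A.
      V \<in> idempotent_evolution_algebras n \<and> natural_basis n V e \<and> structure_matrix n V e A \<longrightarrow>
      A \<in> carrier (GL n) \<and>
      {B \<in> carrier (GL n). algebra_isomorphic class_ring V (evo n B)} =
        orbit (monomial_group n) (evo_act n) A)"
proof (intro conjI ballI allI impI)
  fix V :: "('a, 'v) module" and e A
  assume "V \<in> idempotent_evolution_algebras n \<and> natural_basis n V e \<and> structure_matrix n V e A"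
  then have V: "V \<in> idempotent_evolution_algebras n" and e: "natural_basis n V e"
    and A: "structure_matrix n V e A"
    by auto
  show "A \<in> carrier (GL n)" by (rule structure_matrix_in_GL[OF V e A])
  show "{B \<in> carrier (GL n). algebra_isomorphic class_ring V (evo n B)} =
      orbit (monomial_group n) (evo_act n) A"
    by (rule isomorphic_evo_eq_orbit[OF V e A])
qed (rule monomial_subgroup evo_act_right_action orbits_bij_isomorphism_classes
    | rule evo_act_perm_torus, assumption+)+

end
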